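(* For a generic complex symmetric $10\times10$ matrix $F$ (i.e. for all $F$ in some nonempty Zariski-open subset), the following holds. 1. Bases $\mathsf e_b,\mathsf f_b$ in the edge operator spaces $E_b$ can be chosen, for all ten edges $b$, so that all matrices $A_{ij}$, $1\le i,j\le5$, $i\ne j$, can be taken diagonal. 2. Moreover, if $\mathsf e_b,\mathsf f_b\in E_b$ and $\mathsf e_{b'},\mathsf f_{b'}\in E_{b'}$ are such bases for any two edges $b$ and $b'$, then $[\mathsf e_b,\mathsf e_{b'}]_t=0$ and $[\mathsf f_b,\mathsf f_{b'}]_t=0$ for any individual tetrahedron $t\subset u$. 3. For any triangle $ijk$ (pairwise distinct $i,j,k\in\{1,\dots,5\}$), the two eigenvalues of the automorphism of $E_{ij}$ given by $$\begin{pmatrix}\mathsf e_{ij}\\ \mathsf f_{ij}\end{pmatrix}\mapsto A_{ji}^{-1}A_{jk}A_{kj}^{-1}A_{ki}A_{ik}^{-1}A_{ij}\begin{pmatrix}\mathsf e_{ij}\\ \mathsf f_{ij}\end{pmatrix}$$ are mutually inverse.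
   Context: Let $u=12345$ be a pentachoron (4-simplex); its tetrahedra $t$ are the 4-element subsets and its edges $b=ij$ the 2-element subsets of $\{1,\dots,5\}$. To each tetrahedron $t$ attach two complex variables $x_t,y_t$ and the 4-dimensional space of operators $V_t=\mathrm{span}_{\mathbb C}\{\partial/\partial x_t,\partial/\partial y_t,x_t,y_t\}$ ($x_t,y_t$ acting by multiplication), with symplectic product given by the commutator. Let $V_u=\bigoplus_{t\subset u}V_t$ (20-dimensional). For $d\in V_u$, $d|_t$ denotes its component in $V_t$, and $[d,d']_t=[d|_t,d'|_t]$ is the partial commutator. A symmetric $10\times10$ matrix $F$ (rows and columns indexed by the ten variables, which are listed as $z_1,\dots,z_{10}$) determines the Lagrangian subspace $V_L\subset V_u$ spanned by the ten operators $\partial/\partial z_p+\sum_q F_{pq}z_q$. For an edge $b$, $E_b\subset V_L$ is the space of edge operators: those $d\in V_L$ with $d|_t=0$ for every $t\not\supset b$. For generic $F$, $\dim E_b=2$; choose bases $\mathsf e_b,\mathsf f_b$ of $E_b$, with $\mathsf e_{ij}=\mathsf e_{ji}$, $\mathsf f_{ij}=\mathsf f_{ji}$. For generic $F$, for each vertex $i$ there are nondegenerate $2\times2$ matrices $A_{ij}$ ($j\ne i$) with $$\sum_{j\ne i}A_{ij}\begin{pmatrix}\mathsf e_{ij}\\ \mathsf f_{ij}\end{pmatrix}=0,$$ and, for each fixed $i$, the four matrices $A_{ij}$ are determined up to simultaneous left multiplication by one arbitrary nondegenerate $2\times2$ matrix. *)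

theory Defs
  imports "HOL-Analysis.Analysis"
begin

section \<open>The pentachoron and its variables\<close>

type_synonym vertex = 5

text \<open>A tetrahedron of the pentachoron is named by the vertex opposite to it; an edge is a
  two-element set of vertices.\<close>

definition tet :: "vertex \<Rightarrow> vertex set" where
  "tet t = UNIV - {t}"

definition edges :: "vertex set set" where
  "edges = {b. card b = 2}"

lemma tet_surj: "range tet = {T. card T = 4}"
proof (intro equalityI subsetI)
  fix T :: "vertex set" assume "T \<in> {T. card T = 4}"
  then have "card (UNIV - T) = 1"
    by (simp add: card_Diff_subset)
  then obtain t where "UNIV - T = {t}"
    by (auto simp: card_1_singleton_iff)
  then have "T = tet t" by (auto simp: tet_def)
  then show "T \<in> range tet" by blast
qed (auto simp: tet_def card_Diff_subset)

lemma inj_tet: "inj tet"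
  by (auto simp: inj_def tet_def)

datatype variable = X vertex | Y vertex

primrec var_tet :: "variable \<Rightarrow> vertex" where
  "var_tet (X t) = t"
| "var_tet (Y t) = t"

instance variable :: finite
proof
  have "(UNIV :: variable set) = range X \<union> range Y"
    by (auto intro: variable.exhaust)
  then show "finite (UNIV :: variable set)" by (metis finite finite_Un finite_imageI)
qed

lemma card_var: "CARD(variable) = 10"
proof -
  have "(UNIV :: variable set) = range X \<union> range Y"
    by (auto intro: variable.exhaust)
  moreover have "range X \<inter> range Y = {}" by auto
  moreover have "card (range X) = 5" "card (range Y) = 5"
    by (simp_all add: card_image inj_on_def)
  ultimately show ?thesis
    by (metis (no_types, lifting) card_Un_disjoint finite finite_imageI numeral_Bit0)
qed

section \<open>Operators\<close>

text \<open>The twenty generators of \<open>V\<^sub>u\<close>: \<open>D p\<close> stands for the derivation in the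
  variable \<open>p\<close>, and \<open>Z p\<close> for multiplication by \<open>p\<close>. An element of \<open>V\<^sub>u\<close> is the vector
  of its coefficients.\<close>

datatype gen = D variable | Z variable

primrec gen_tet :: "gen \<Rightarrow> vertex" where
  "gen_tet (D p) = var_tet p"
| "gen_tet (Z p) = var_tet p"

lemma UNIV_gen: "(UNIV :: gen set) = range D \<union> range Z"
  by (auto intro: gen.exhaust)

instance gen :: finite
  by standard (simp add: UNIV_gen)

type_synonym opr = "complex^gen"

text \<open>The commutator, from \<open>[\<partial>/\<partial>p, p] = 1\<close>; see \<open>commutator_act\<close> below.\<close>

definition comm :: "opr \<Rightarrow> opr \<Rightarrow> complex" where
  "comm d d' = (\<Sum>p\<in>UNIV. d $ D p * d' $ Z p - d $ Z p * d' $ D p)"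

definition component :: "vertex \<Rightarrow> opr \<Rightarrow> opr" where
  "component t d = (\<chi> g. if gen_tet g = t then d $ g else 0)"

definition pcomm :: "vertex \<Rightarrow> opr \<Rightarrow> opr \<Rightarrow> complex" where
  "pcomm t d d' = comm (component t d) (component t d')"

subsection \<open>Polynomial functions\<close>

inductive_set polyfun :: "('a \<Rightarrow> complex) set \<Rightarrow> ('a \<Rightarrow> complex) set"
  for C :: "('a \<Rightarrow> complex) set" where
  const: "(\<lambda>_. c) \<in> polyfun C"
| coord: "x \<in> C \<Longrightarrow> x \<in> polyfun C"
| add: "f \<in> polyfun C \<Longrightarrow> g \<in> polyfun C \<Longrightarrow> (\<lambda>z. f z + g z) \<in> polyfun C"
| mult: "f \<in> polyfun C \<Longrightarrow> g \<in> polyfun C \<Longrightarrow> (\<lambda>z. f z * g z) \<in> polyfun C"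

abbreviation poly_vars :: "(complex^variable \<Rightarrow> complex) set" where
  "poly_vars \<equiv> polyfun (range (\<lambda>p z. z $ p))"

subsection \<open>Coefficient vectors as differential operators\<close>

definition pd :: "variable \<Rightarrow> (complex^variable \<Rightarrow> complex) \<Rightarrow> complex^variable \<Rightarrow> complex" where
  "pd p f z = deriv (\<lambda>s. f (z + axis p s)) 0"

definition act :: "opr \<Rightarrow> (complex^variable \<Rightarrow> complex) \<Rightarrow> complex^variable \<Rightarrow> complex" where
  "act d f z = (\<Sum>p\<in>UNIV. d $ D p * pd p f z + d $ Z p * (z $ p * f z))"

definition has_pd :: "variable \<Rightarrow> (complex^variable \<Rightarrow> complex) \<Rightarrow> (complex^variable \<Rightarrow> complex) \<Rightarrow> bool" where
  "has_pd p f f' \<longleftrightarrow> (\<forall>z. ((\<lambda>s. f (z + axis p s)) has_field_derivative f' z) (at 0))"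

lemma has_pd_imp_pd: "has_pd p f f' \<Longrightarrow> pd p f = f'"
  by (auto simp: has_pd_def pd_def fun_eq_iff intro: DERIV_imp_deriv)

lemma axis_0 [simp]: "axis p (0::complex) = 0"
  by (simp add: vec_eq_iff axis_def)

lemma has_pd_const: "has_pd p (\<lambda>_. c) (\<lambda>_. 0)"
  by (simp add: has_pd_def)

lemma has_pd_coord: "has_pd p (\<lambda>z. z $ q) (\<lambda>_. if p = q then 1 else 0)"
  by (auto simp: has_pd_def axis_def intro!: derivative_eq_intros)

lemma has_pd_add:
  "has_pd p f f' \<Longrightarrow> has_pd p g g' \<Longrightarrow> has_pd p (\<lambda>z. f z + g z) (\<lambda>z. f' z + g' z)"
  by (auto simp: has_pd_def intro: DERIV_add)

lemma has_pd_mult: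
  "has_pd p f f' \<Longrightarrow> has_pd p g g' \<Longrightarrow> has_pd p (\<lambda>z. f z * g z) (\<lambda>z. f' z * g z + f z * g' z)"
  unfolding has_pd_def by (auto intro!: derivative_eq_intros)

lemma has_pd_poly: "f \<in> poly_vars \<Longrightarrow> has_pd p f (pd p f) \<and> pd p f \<in> poly_vars"
proof (induction rule: polyfun.induct)
  case (const c)
  then show ?case
    using has_pd_const[of p c] has_pd_imp_pd[OF has_pd_const[of p c]] by (auto intro: polyfun.const)
next
  case (coord x)
  then obtain q where "x = (\<lambda>z. z $ q)" by auto
  then show ?case
    using has_pd_coord[of p q] has_pd_imp_pd[OF has_pd_coord[of p q]] by (auto intro: polyfun.const)
next
  case (add f g)
  then show ?case
    using has_pd_add[of p f "pd p f" g "pd p g"] has_pd_imp_pd by (auto intro: polyfun.add)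
next
  case (mult f g)
  then have "has_pd p (\<lambda>z. f z * g z) (\<lambda>z. pd p f z * g z + f z * pd p g z)"
    by (intro has_pd_mult) auto
  moreover have "(\<lambda>z. pd p f z * g z + f z * pd p g z) \<in> poly_vars"
    using mult by (intro polyfun.add polyfun.mult) auto
  ultimately show ?case by (metis has_pd_imp_pd)
qed

lemma pd_const: "pd p (\<lambda>_. c) = (\<lambda>_. 0)"
  by (rule has_pd_imp_pd[OF has_pd_const])

lemma pd_coord: "pd p (\<lambda>z. z $ q) = (\<lambda>_. if p = q then 1 else 0)"
  by (rule has_pd_imp_pd[OF has_pd_coord])

lemma pd_add:
  "f \<in> poly_vars \<Longrightarrow> g \<in> poly_vars \<Longrightarrow> pd p (\<lambda>z. f z + g z) = (\<lambda>z. pd p f z + pd p g z)"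
  by (intro has_pd_imp_pd has_pd_add) (auto simp: has_pd_poly)

lemma pd_mult:
  "f \<in> poly_vars \<Longrightarrow> g \<in> poly_vars
    \<Longrightarrow> pd p (\<lambda>z. f z * g z) = (\<lambda>z. pd p f z * g z + f z * pd p g z)"
  by (intro has_pd_imp_pd has_pd_mult) (auto simp: has_pd_poly)

lemma pd_commute: "f \<in> poly_vars \<Longrightarrow> pd p (pd q f) = pd q (pd p f)"
proof (induction rule: polyfun.induct)
  case (mult f g)
  then show ?case
    by (simp add: pd_mult pd_add has_pd_poly polyfun.mult fun_eq_iff algebra_simps)
qed (auto simp: pd_const pd_coord pd_add has_pd_poly)

lemma poly_vars_sum:
  "finite I \<Longrightarrow> (\<And>i. i \<in> I \<Longrightarrow> h i \<in> poly_vars) \<Longrightarrow> (\<lambda>z. \<Sum>i\<in>I. h i z) \<in> poly_vars"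
  by (induction I rule: finite_induct) (auto intro: polyfun.const polyfun.add)

lemma pd_sum:
  "finite I \<Longrightarrow> (\<And>i. i \<in> I \<Longrightarrow> h i \<in> poly_vars)
    \<Longrightarrow> pd p (\<lambda>z. \<Sum>i\<in>I. h i z) = (\<lambda>z. \<Sum>i\<in>I. pd p (h i) z)"
  by (induction I rule: finite_induct) (auto simp: pd_const pd_add poly_vars_sum)

lemma poly_vars_coord: "(\<lambda>z. z $ p) \<in> poly_vars"
  by (auto intro: polyfun.coord)

lemma act_poly:
  assumes "f \<in> poly_vars"
  shows "act d f \<in> poly_vars"
proof -
  have "(\<lambda>z. \<Sum>p\<in>UNIV. d $ D p * pd p f z + d $ Z p * (z $ p * f z)) \<in> poly_vars"
    by (intro poly_vars_sum polyfun.add polyfun.mult polyfun.const poly_vars_coord)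
       (use assms in \<open>auto simp: has_pd_poly\<close>)
  then show ?thesis unfolding act_def[abs_def] .
qed

lemma pd_act:
  assumes f: "f \<in> poly_vars"
  shows "pd p (act d f) z = act d (pd p f) z + d $ Z p * f z"
proof -
  note mem = has_pd_poly[OF f, THEN conjunct2] poly_vars_coord polyfun.const polyfun.mult
    polyfun.add f
  have "pd p (\<lambda>z. \<Sum>q\<in>UNIV. d $ D q * pd q f z + d $ Z q * (z $ q * f z)) =
      (\<lambda>z. \<Sum>q\<in>UNIV. pd p (\<lambda>z. d $ D q * pd q f z + d $ Z q * (z $ q * f z)) z)"
    by (intro pd_sum) (auto intro!: mem)
  also have "\<dots> = (\<lambda>z. \<Sum>q\<in>UNIV. d $ D q * pd q (pd p f) z + d $ Z q * (z $ q * pd p f z)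
      + (if p = q then d $ Z q * f z else 0))"
    by (simp add: pd_add pd_mult pd_const pd_coord mem pd_commute[OF f, of p] fun_eq_iff
        cong: if_cong)
       (auto intro!: sum.cong simp: algebra_simps)
  finally show ?thesis
    by (simp add: act_def[abs_def] sum.distrib)
qed

lemma commutator_act:
  assumes f: "f \<in> poly_vars"
  shows "act d (act d' f) z - act d' (act d f) z = comm d d' * f z"
proof -
  have pdf: "pd p f \<in> poly_vars" for p using has_pd_poly[OF f] by blast
  have *: "act d (act d' f) z = (\<Sum>p\<in>UNIV. \<Sum>q\<in>UNIV.
      d $ D p * (d' $ D q * pd q (pd p f) z) + d $ D p * (d' $ Z q * (z $ q * pd p f z))
      + d $ Z p * (z $ p * (d' $ D q * pd q f z)) + d $ Z p * (z $ p * (d' $ Z q * (z $ q * f z))))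
      + (\<Sum>p\<in>UNIV. d $ D p * d' $ Z p) * f z" for d d'
    unfolding act_def[of d] pd_act[OF f]
    by (simp add: act_def sum.distrib sum_distrib_left sum_distrib_right algebra_simps)
  have "(\<Sum>p\<in>UNIV. \<Sum>q\<in>UNIV.
      d $ D p * (d' $ D q * pd q (pd p f) z) + d $ D p * (d' $ Z q * (z $ q * pd p f z))
      + d $ Z p * (z $ p * (d' $ D q * pd q f z)) + d $ Z p * (z $ p * (d' $ Z q * (z $ q * f z))))
    = (\<Sum>p\<in>UNIV. \<Sum>q\<in>UNIV.
      d' $ D p * (d $ D q * pd q (pd p f) z) + d' $ D p * (d $ Z q * (z $ q * pd p f z))
      + d' $ Z p * (z $ p * (d $ D q * pd q f z)) + d' $ Z p * (z $ p * (d $ Z q * (z $ q * f z))))"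
    by (subst sum.swap) (intro sum.cong refl, simp add: pd_commute[OF f] algebra_simps)
  then show ?thesis
    unfolding * comm_def by (simp add: sum_subtractf algebra_simps)
qed

lemma act_inject:
  assumes "\<And>f. f \<in> poly_vars \<Longrightarrow> act d f = act d' f"
  shows "d = d'"
proof -
  have Zeq: "d $ Z p = d' $ Z p" for p
  proof -
    have "act d (\<lambda>_. 1) (axis p 1) = act d' (\<lambda>_. 1) (axis p 1)"
      using assms[OF polyfun.const] by simp
    then show ?thesis
      by (simp add: act_def pd_const axis_def if_distrib[of "(*) _"] cong: if_cong)
  qed
  have Deq: "d $ D p = d' $ D p" for p
  proof -
    have "act d (\<lambda>z. z $ p) 0 = act d' (\<lambda>z. z $ p) 0"
      using assms[OF poly_vars_coord] by simp
    then show ?thesis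
      by (simp add: act_def pd_coord if_distrib[of "(*) _"] cong: if_cong)
  qed
  show ?thesis
    unfolding vec_eq_iff
  proof
    fix g show "d $ g = d' $ g" by (cases g) (simp_all add: Zeq Deq)
  qed
qed

section \<open>The Lagrangian subspace and the edge operators\<close>

definition lag_gen :: "complex^variable^variable \<Rightarrow> variable \<Rightarrow> opr" where
  "lag_gen F p = axis (D p) 1 + (\<Sum>q\<in>UNIV. F $ p $ q *s axis (Z q) 1)"

definition lag :: "complex^variable^variable \<Rightarrow> opr set" where
  "lag F = vec.span (range (lag_gen F))"

definition edge_space :: "complex^variable^variable \<Rightarrow> vertex set \<Rightarrow> opr set" where
  "edge_space F b = {d \<in> lag F. \<forall>t. \<not> b \<subseteq> tet t \<longrightarrow> component t d = 0}"

text \<open>Bases are indexed by the edge as a set, so that \<open>e\<^sub>i\<^sub>j = e\<^sub>j\<^sub>i\<close> holds by itself.\<close>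

definition edge_bases ::
  "complex^variable^variable \<Rightarrow> (vertex set \<Rightarrow> opr) \<Rightarrow> (vertex set \<Rightarrow> opr) \<Rightarrow> bool" where
  "edge_bases F e f \<longleftrightarrow> (\<forall>b\<in>edges. e b \<noteq> f b \<and> vec.independent {e b, f b} \<and>
     vec.span {e b, f b} = edge_space F b)"

text \<open>The values \<open>A i i\<close> play no role.\<close>

definition edge_relations ::
  "(vertex set \<Rightarrow> opr) \<Rightarrow> (vertex set \<Rightarrow> opr) \<Rightarrow> (vertex \<Rightarrow> vertex \<Rightarrow> complex^2^2) \<Rightarrow> bool" where
  "edge_relations e f A \<longleftrightarrow> (\<forall>i j. i \<noteq> j \<longrightarrow> invertible (A i j)) \<and>
     (\<forall>i r. (\<Sum>j\<in>UNIV - {i}. A i j $ r $ 1 *s e {i, j} + A i j $ r $ 2 *s f {i, j}) = 0)"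

definition all_diagonal :: "(vertex \<Rightarrow> vertex \<Rightarrow> complex^2^2) \<Rightarrow> bool" where
  "all_diagonal A \<longleftrightarrow> (\<forall>i j. i \<noteq> j \<longrightarrow> (\<forall>r s. r \<noteq> s \<longrightarrow> A i j $ r $ s = 0))"

definition triangle_matrix ::
  "(vertex \<Rightarrow> vertex \<Rightarrow> complex^2^2) \<Rightarrow> vertex \<Rightarrow> vertex \<Rightarrow> vertex \<Rightarrow> complex^2^2" where
  "triangle_matrix A i j k =
     matrix_inv (A j i) ** A j k ** matrix_inv (A k j) ** A k i ** matrix_inv (A i k) ** A i j"

text \<open>The linear map is total, but only its restriction to the span of the basis \<open>e, f\<close> matters;
  the rows of \<open>M\<close> are the coordinates of the images of \<open>e\<close> and \<open>f\<close>.\<close>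

definition maps_basis :: "opr \<Rightarrow> opr \<Rightarrow> complex^2^2 \<Rightarrow> (opr \<Rightarrow> opr) \<Rightarrow> bool" where
  "maps_basis e f M \<phi> \<longleftrightarrow> Vector_Spaces.linear (*s) (*s) \<phi> \<and>
     \<phi> e = M $ 1 $ 1 *s e + M $ 1 $ 2 *s f \<and>
     \<phi> f = M $ 2 $ 1 *s e + M $ 2 $ 2 *s f"

text \<open>For a two-dimensional \<open>E\<close>, \<open>eigenvalues_on E \<phi> = {\<mu>, inverse \<mu>}\<close> with \<open>\<mu> \<noteq> 0\<close> says that the
  two eigenvalues are mutually inverse also when counted with multiplicity: a single eigenvalue
  then satisfies \<open>\<mu>\<^sup>2 = 1\<close>.\<close>

definition eigenvalues_on :: "opr set \<Rightarrow> (opr \<Rightarrow> opr) \<Rightarrow> complex set" where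
  "eigenvalues_on E \<phi> = {\<mu>. \<exists>v\<in>E. v \<noteq> 0 \<and> \<phi> v = \<mu> *s v}"

section \<open>Zariski-open sets of symmetric matrices\<close>

definition sym_matrices :: "(complex^variable^variable) set" where
  "sym_matrices = {F. transpose F = F}"

definition zariski_open :: "(complex^variable^variable) set \<Rightarrow> bool" where
  "zariski_open U \<longleftrightarrow> (\<exists>S \<subseteq> polyfun (range (\<lambda>(p, q) F. F $ p $ q)).
     U = {F \<in> sym_matrices. \<exists>P\<in>S. P F \<noteq> 0})"

end

theory Submission
  imports Defs
begin

text \<open>Opposite edges \<open>ij\<close>, \<open>kl\<close> share one tetrahedron, so their operators commute there.
  Pairing the vertex relations at \<open>i\<close>, \<open>j\<close>, \<open>k\<close> with the edges of the triangle \<open>ijk\<close> in a tetrahedron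
  containing it therefore expresses ratios of the \<open>det A\<^sub>i\<^sub>j\<close> by Gram determinants that cancel around
  the triangle. So the triangle holonomy has determinant 1; it is the operator \<open>\<alpha>\<^sup>-\<^sup>1\<alpha>\<^sup>T\<close> of
  the nondegenerate bilinear form \<open>\<alpha>(u, v) = [u\<^sub>i\<^sub>j, v\<^sub>i\<^sub>k]\<^sub>t\<close> on the relations \<open>u\<close>, \<open>v\<close> at \<open>i\<close>.

  Up to sign, \<open>\<alpha>(u, u)\<close> does not depend on \<open>j\<close>, \<open>k\<close>, \<open>t\<close> and is preserved when a relation is carried
  across an edge. Eigenvectors of the holonomy of one triangle with eigenvalues different from
  \<open>\<plusminus>1\<close> are isotropic, and isotropic relations are eigenvectors for all triangles; this
  diagonalizes all \<open>A\<^sub>i\<^sub>j\<close> at once and gives the vanishing partial commutators.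

  Genericity means that some linear systems with polynomial coefficients have only the trivial
  solution, which is a Zariski-open condition, nonempty because of one explicit matrix.\<close>

section \<open>Completing distinct vertices to all five\<close>

lemma distinct5_UNIV:
  fixes i :: vertex
  assumes "distinct [i, j, k, l, m]"
  shows "UNIV = {i, j, k, l, m}"
proof -
  have "card {i, j, k, l, m} = CARD(5)"
    using assms by simp
  then show ?thesis
    by (metis card_subset_eq finite subset_UNIV)
qed

lemma distinct3_extend:
  fixes i :: vertex
  assumes "distinct [i, j, k]"
  obtains l m where "distinct [i, j, k, l, m]"
proof -
  have "card (UNIV - {i, j, k}) = 2"
    using assms by (simp add: card_Diff_subset)
  then obtain l m where "UNIV - {i, j, k} = {l, m}" "l \<noteq> m"
    by (auto simp: card_2_iff)
  then have "distinct [i, j, k, l, m]"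
    using assms by auto
  then show thesis ..
qed

lemma distinct4_extend:
  fixes i :: vertex
  assumes "distinct [i, j, k, t]"
  obtains l where "distinct [i, j, k, l, t]"
proof -
  obtain l m where "distinct [i, j, k, l, m]"
    using distinct3_extend[of i j k] assms by auto
  with assms distinct5_UNIV[OF this] that[of l] that[of m] show thesis
    by auto
qed

lemma distinct2_extend:
  fixes i :: vertex
  assumes "i \<noteq> j"
  obtains k l m where "distinct [i, j, k, l, m]"
proof -
  have "card (UNIV - {i, j}) \<noteq> 0"
    using assms by (simp add: card_Diff_subset)
  then have "UNIV - {i, j} \<noteq> {}"
    by (metis card.empty)
  then obtain k where "k \<notin> {i, j}"
    by blast
  then have "distinct [i, j, k]"
    using assms by auto
  then show thesis
    using that by (rule distinct3_extend)
qed

section \<open>Partial commutators\<close>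

lemma component_nth [simp]: "component t d $ g = (if gen_tet g = t then d $ g else 0)"
  by (simp add: component_def)

lemma component_eq_0_iff: "component t d = 0 \<longleftrightarrow> (\<forall>g. gen_tet g = t \<longrightarrow> d $ g = 0)"
  by (auto simp: vec_eq_iff)

lemma component_add: "component t (d + d') = component t d + component t d'"
  and component_diff: "component t (d - d') = component t d - component t d'"
  and component_uminus: "component t (- d) = - component t d"
  and component_scale: "component t (c *s d) = c *s component t d"
  and component_zero [simp]: "component t 0 = 0"
  by (simp_all add: vec_eq_iff)

lemma pcomm_eq:
  "pcomm t d d' = (\<Sum>p | var_tet p = t. d $ D p * d' $ Z p - d $ Z p * d' $ D p)"
  unfolding pcomm_def comm_def by (intro sum.mono_neutral_cong_right) auto

lemma comm_eq_sum_pcomm: "comm d d' = (\<Sum>t\<in>UNIV. pcomm t d d')"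
proof -
  have "(\<Sum>t\<in>UNIV. pcomm t d d') = (\<Sum>t\<in>UNIV. \<Sum>p\<in>{p\<in>UNIV. var_tet p = t}.
      d $ D p * d' $ Z p - d $ Z p * d' $ D p)"
    by (simp add: pcomm_eq)
  also have "\<dots> = comm d d'"
    unfolding comm_def by (rule sum.group) auto
  finally show ?thesis ..
qed

lemma pcomm_add_left: "pcomm t (d + d') w = pcomm t d w + pcomm t d' w"
  and pcomm_add_right: "pcomm t w (d + d') = pcomm t w d + pcomm t w d'"
  and pcomm_scale_left: "pcomm t (c *s d) w = c * pcomm t d w"
  and pcomm_scale_right: "pcomm t w (c *s d) = c * pcomm t w d"
  by (simp_all add: pcomm_eq sum.distrib[symmetric] sum_distrib_left algebra_simps)

lemma pcomm_zero [simp]: "pcomm t 0 w = 0" "pcomm t w 0 = 0"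
  by (simp_all add: pcomm_eq)

lemma pcomm_sum_right: "pcomm t w (\<Sum>j\<in>J. d j) = (\<Sum>j\<in>J. pcomm t w (d j))"
  by (induction J rule: infinite_finite_induct) (simp_all add: pcomm_add_right)

lemma pcomm_swap: "pcomm t d' d = - pcomm t d d'"
  by (simp add: pcomm_eq sum_negf[symmetric] algebra_simps)

lemma pcomm_self [simp]: "pcomm t d d = 0"
  by (simp add: pcomm_eq)

lemma pcomm_component_zero:
  "component t d = 0 \<Longrightarrow> pcomm t d w = 0"
  "component t d = 0 \<Longrightarrow> pcomm t w d = 0"
  by (simp_all add: pcomm_eq component_eq_0_iff)

lemma pcomm_cong_right: "component t d = component t d' \<Longrightarrow> pcomm t w d = pcomm t w d'"
  by (simp add: pcomm_def)

lemma pcomm_nondegenerate: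
  assumes "\<And>w. pcomm t d w = 0"
  shows "component t d = 0"
  unfolding component_eq_0_iff
proof (intro allI impI)
  fix g assume g: "gen_tet g = t"
  show "d $ g = 0"
  proof (cases g)
    case (D p)
    then show ?thesis
      using assms[of "axis (Z p) 1"] g
      by (simp add: pcomm_eq axis_def if_distrib[of "(*) _"] cong: if_cong)
  next
    case (Z p)
    then show ?thesis
      using assms[of "axis (D p) 1"] g
      by (simp add: pcomm_eq axis_def sum_negf if_distrib[of "(*) _"] cong: if_cong)
  qed
qed

section \<open>The Lagrangian subspace\<close>

text \<open>\<open>lag F\<close> is a graph over the derivation coefficients, so \<open>x\<close>
  serves as a coordinate vector on it.\<close>

definition lag_opr :: "complex^variable^variable \<Rightarrow> complex^variable \<Rightarrow> opr" where
  "lag_opr F x = (\<chi> g. case g of D p \<Rightarrow> x $ p | Z q \<Rightarrow> \<Sum>p\<in>UNIV. F $ p $ q * x $ p)"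

lemma lag_opr_nth [simp]:
  "lag_opr F x $ D p = x $ p"
  "lag_opr F x $ Z q = (\<Sum>p\<in>UNIV. F $ p $ q * x $ p)"
  by (simp_all add: lag_opr_def)

lemma opr_eq_iff: "(d :: opr) = d' \<longleftrightarrow> (\<forall>p. d $ D p = d' $ D p) \<and> (\<forall>p. d $ Z p = d' $ Z p)"
  unfolding vec_eq_iff by (metis gen.exhaust)

lemma lag_opr_linear: "Vector_Spaces.linear (*s) (*s) (lag_opr F)"
  by unfold_locales
     (simp_all add: opr_eq_iff sum.distrib[symmetric] sum_distrib_left algebra_simps)

lemma inj_lag_opr: "inj (lag_opr F)"
  by (auto simp: inj_def opr_eq_iff vec_eq_iff)

lemma lag_opr_eq_sum: "lag_opr F x = (\<Sum>p\<in>UNIV. x $ p *s lag_gen F p)"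
  by (simp add: opr_eq_iff lag_gen_def axis_def sum_component if_distrib[of "(*) _"] mult.commute
      cong: if_cong)

lemma lag_eq_range: "lag F = range (lag_opr F)"
proof
  have "lag_gen F p = lag_opr F (axis p 1)" for p
    by (simp add: lag_opr_eq_sum axis_def if_distrib[of "\<lambda>c. c *s _"] cong: if_cong)
  moreover have "vec.subspace (range (lag_opr F))"
    using lag_opr_linear by (rule vec.linear_subspace_image) (rule vec.subspace_UNIV)
  ultimately show "lag F \<subseteq> range (lag_opr F)"
    unfolding lag_def by (intro vec.span_minimal) auto
  show "range (lag_opr F) \<subseteq> lag F"
    unfolding lag_def lag_opr_eq_sum[abs_def]
    by (auto intro!: vec.span_sum vec.span_scale intro: vec.span_base)
qed

lemma subspace_lag: "vec.subspace (lag F)"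
  by (simp add: lag_def)

lemma dim_lag: "vec.dim (lag F) = 10"
proof -
  have "vec.dim (lag F) = vec.dim (UNIV :: (complex^variable) set)"
    unfolding lag_eq_range by (rule vec.dim_image_eq[OF lag_opr_linear]) (simp add: inj_lag_opr inj_on_subset)
  then show ?thesis
    by (simp add: card_var card_cart_basis)
qed

text \<open>Tetrahedra are named by their opposite vertices, so the ones that do not contain the
  edge \<open>ij\<close> are \<open>tet i\<close> and \<open>tet j\<close>.\<close>

lemma edge_space_iff:
  "d \<in> edge_space F {i, j} \<longleftrightarrow> d \<in> lag F \<and> component i d = 0 \<and> component j d = 0"
  by (auto simp: edge_space_def tet_def)

lemma subspace_edge_space: "vec.subspace (edge_space F b)"
  using subspace_lag[of F]
  by (auto simp: edge_space_def vec.subspace_def component_add component_scale)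

lemma card_gens_of_tet: "card {g. gen_tet g = t} = 4"
proof -
  have "{g. gen_tet g = t} = {D (X t), D (Y t), Z (X t), Z (Y t)}"
  proof (intro equalityI subsetI)
    fix g assume "g \<in> {g. gen_tet g = t}"
    then show "g \<in> {D (X t), D (Y t), Z (X t), Z (Y t)}"
      by (cases g; cases "case g of D p \<Rightarrow> p | Z p \<Rightarrow> p") auto
  qed auto
  then show ?thesis by simp
qed

text \<open>Dimension count, valid for every \<open>F\<close>: inside the 20-dimensional space, the
  10-dimensional \<open>lag F\<close> meets the 12-dimensional space of operators vanishing on two
  tetrahedra in dimension at least 2.\<close>

lemma dim_edge_space_ge:
  assumes "i \<noteq> j"
  shows "2 \<le> vec.dim (edge_space F {i, j})"
proof -
  let ?G = "{g. gen_tet g \<noteq> i \<and> gen_tet g \<noteq> j}"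
  let ?N = "{d :: opr. \<forall>g. g \<notin> ?G \<longrightarrow> d $ g = 0}"
  have "range D \<inter> range Z = {}"
    by auto
  then have card_gen: "CARD(gen) = 20"
    unfolding UNIV_gen by (simp add: card_Un_disjoint card_image inj_on_def card_var)
  have "?G = UNIV - ({g. gen_tet g = i} \<union> {g. gen_tet g = j})"
    by auto
  moreover have "card ({g. gen_tet g = i} \<union> {g. gen_tet g = j}) = 8"
    using assms by (simp add: card_Un_disjoint card_gens_of_tet disjoint_iff)
  ultimately have "card ?G = 12"
    by (simp add: card_Diff_subset card_gen)
  then have "vec.dim ?N = 12"
    by (simp only: dim_substandard_cart)
  moreover have "vec.subspace ?N"
    by (auto simp: vec.subspace_def)
  moreover have "lag F \<inter> ?N = edge_space F {i, j}"
    by (auto simp: edge_space_iff component_eq_0_iff)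
  ultimately have "vec.dim {x + y |x y. x \<in> lag F \<and> y \<in> ?N} + vec.dim (edge_space F {i, j}) = 22"
    using vec.dim_sums_Int[OF subspace_lag, of ?N F] by (simp add: dim_lag)
  moreover have "vec.dim {x + y |x y. x \<in> lag F \<and> y \<in> ?N} \<le> 20"
    using vec.dim_subset[OF subset_UNIV] by (rule order_trans) (simp add: card_gen card_cart_basis)
  ultimately show ?thesis
    by linarith
qed

text \<open>Symmetry of \<open>F\<close> makes \<open>lag F\<close> isotropic for the full
  commutator: the two double sums agree after exchanging the summation indices.\<close>

lemma comm_lag:
  assumes "transpose F = F" "d \<in> lag F" "d' \<in> lag F"
  shows "comm d d' = 0"
proof -
  obtain x y where "d = lag_opr F x" "d' = lag_opr F y"
    using assms by (auto simp: lag_eq_range)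
  moreover have "F $ p $ q = F $ q $ p" for p q
    using arg_cong[OF assms(1), of "\<lambda>F. F $ p $ q"] by (simp add: transpose_def)
  moreover have "(\<Sum>p\<in>UNIV. \<Sum>q\<in>UNIV. x $ p * (F $ q $ p * y $ q)) =
      (\<Sum>p\<in>UNIV. \<Sum>q\<in>UNIV. F $ p $ q * x $ p * y $ q)"
    using calculation by (simp add: algebra_simps)
  moreover have "(\<Sum>p\<in>UNIV. \<Sum>q\<in>UNIV. F $ q $ p * x $ q * y $ p) =
      (\<Sum>p\<in>UNIV. \<Sum>q\<in>UNIV. F $ p $ q * x $ p * y $ q)"
    by (rule sum.swap)
  ultimately show ?thesis
    by (simp add: comm_def sum_subtractf sum_distrib_left sum_distrib_right)
qed

section \<open>Vertex relations\<close>

text \<open>A basis-free form of the vertex relations: every combination of the two rows of the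
  relation at \<open>i\<close> is such a family. The convention \<open>r i = 0\<close> lets the sum
  run over all vertices.\<close>

definition relations :: "complex^variable^variable \<Rightarrow> vertex \<Rightarrow> (vertex \<Rightarrow> opr) set" where
  "relations F i = {r. r i = 0 \<and> (\<forall>j. j \<noteq> i \<longrightarrow> r j \<in> edge_space F {i, j}) \<and> (\<Sum>j\<in>UNIV. r j) = 0}"

lemma relations_scale: "r \<in> relations F i \<Longrightarrow> (\<lambda>j. c *s r j) \<in> relations F i"
  using subspace_edge_space[of F]
  by (auto simp: relations_def vec.subspace_scale vec.scale_sum_right[symmetric])

lemma relations_add:
  "r \<in> relations F i \<Longrightarrow> s \<in> relations F i \<Longrightarrow> (\<lambda>j. r j + s j) \<in> relations F i"
  using subspace_edge_space[of F]
  by (auto simp: relations_def vec.subspace_add sum.distrib)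

lemma relations_edge: "r \<in> relations F i \<Longrightarrow> i \<noteq> j \<Longrightarrow> r j \<in> edge_space F {i, j}"
  by (auto simp: relations_def)

section \<open>Isotropy\<close>

locale lagrangian =
  fixes F :: "complex^variable^variable"
  assumes symmetric: "transpose F = F"
begin

text \<open>Each of the tetrahedra \<open>i\<close>, \<open>j\<close>, \<open>k\<close>,
  \<open>l\<close> misses one of the two edges, so the vanishing full commutator reduces to its term
  at \<open>t\<close>.\<close>

lemma pcomm_opposite:
  assumes "distinct [i, j, k, l, t]" "d \<in> edge_space F {i, j}" "d' \<in> edge_space F {k, l}"
  shows "pcomm t d d' = 0"
proof -
  have "comm d d' = 0"
    using assms by (intro comm_lag[OF symmetric]) (auto simp: edge_space_iff)
  then show ?thesis
    using assms by (simp add: comm_eq_sum_pcomm distinct5_UNIV[OF assms(1)] edge_space_iff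
        pcomm_component_zero)
qed

text \<open>Only the tetrahedra \<open>l\<close> and \<open>t\<close> contain both edges, and the
  two terms of the full commutator cancel.\<close>

lemma pcomm_adjacent:
  assumes "distinct [i, j, k, l, t]" "d \<in> edge_space F {i, j}" "d' \<in> edge_space F {i, k}"
  shows "pcomm l d d' = - pcomm t d d'"
proof -
  have "comm d d' = 0"
    using assms by (intro comm_lag[OF symmetric]) (auto simp: edge_space_iff)
  then show ?thesis
    using assms by (simp add: comm_eq_sum_pcomm distinct5_UNIV[OF assms(1)] edge_space_iff
        pcomm_component_zero add_eq_0_iff2)
qed

lemma relations_pcomm:
  assumes "distinct [i, j, k, l, t]" "r \<in> relations F i"
  shows "pcomm t w (r j) + pcomm t w (r k) + pcomm t w (r l) = 0"
proof -
  have "component t (r t) = 0"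
    using assms by (auto simp: relations_def edge_space_iff)
  moreover have "(\<Sum>j\<in>UNIV. pcomm t w (r j)) = 0"
    using assms by (simp add: relations_def flip: pcomm_sum_right)
  ultimately show ?thesis
    using assms by (simp add: distinct5_UNIV[OF assms(1)] relations_def pcomm_component_zero
        add.assoc)
qed

text \<open>Among the three terms of the relation that live on \<open>t\<close>, the one at the edge
  \<open>il\<close> drops out, since \<open>il\<close> is opposite to \<open>jk\<close>
  there.\<close>

lemma relations_triangle:
  assumes "distinct [i, j, k, t]" "r \<in> relations F i" "d \<in> edge_space F {j, k}"
  shows "pcomm t d (r k) = - pcomm t d (r j)"
proof -
  obtain l where l: "distinct [i, j, k, l, t]"
    using assms(1) by (rule distinct4_extend)
  have "r l \<in> edge_space F {i, l}"
    using assms(2) l by (intro relations_edge) auto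
  then have "pcomm t d (r l) = 0"
    using l by (intro pcomm_opposite[OF _ assms(3)]) auto
  then show ?thesis
    using relations_pcomm[OF l assms(2), of d] by (simp add: add_eq_0_iff)
qed

text \<open>Scaling a relation around the triangle by \<open>\<mu>\<close> amounts to multiplying \<open>[p\<^sub>j, p\<^sub>k]\<^sub>t\<close> by \<open>\<mu>\<close>.\<close>

lemma holonomy_isotropic:
  assumes "distinct [i, j, k, t]"
    and p: "p \<in> relations F i" and q: "q \<in> relations F j" and r: "r \<in> relations F k"
    and "q k = r j" "r i = p k" "p j = \<mu> *s q i" "\<mu> \<noteq> 1"
  shows "pcomm t (p j) (p k) = 0"
proof -
  have edges: "q k \<in> edge_space F {j, k}" "p k \<in> edge_space F {i, k}" "p j \<in> edge_space F {i, j}"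
    using relations_edge[OF q, of k] relations_edge[OF p] assms(1) by auto
  \<comment> \<open>Each vertex relation is paired with the triangle edge opposite to its vertex.
    The three equations, chained through the shared edge values, return to the initial pairing with
    the factor \<open>\<mu>\<close>.\<close>
  have "pcomm t (q k) (p k) = - pcomm t (q k) (p j)"
    by (rule relations_triangle[OF _ p edges(1)]) (use assms(1) in auto)
  moreover have "pcomm t (p k) (q k) = - pcomm t (p k) (q i)"
    by (rule relations_triangle[OF _ q edges(2)]) (use assms(1) in auto)
  moreover have "pcomm t (p j) (r j) = - pcomm t (p j) (r i)"
    by (rule relations_triangle[OF _ r edges(3)]) (use assms(1) in auto)
  moreover have "pcomm t (p k) (p j) = \<mu> * pcomm t (p k) (q i)"
    using assms by (simp add: pcomm_scale_right)
  ultimately have "pcomm t (p j) (p k) = \<mu> * pcomm t (p j) (p k)"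
    using pcomm_swap[of t "p j" "p k"] pcomm_swap[of t "q k" "p j"] pcomm_swap[of t "q k" "p k"]
      assms(5,6) by simp
  then show ?thesis
    using assms by simp
qed

definition isotropic :: "vertex \<Rightarrow> (vertex \<Rightarrow> opr) \<Rightarrow> bool" where
  "isotropic i r \<longleftrightarrow> (\<forall>j k t. distinct [i, j, k, t] \<longrightarrow> pcomm t (r j) (r k) = 0)"

text \<open>One choice of \<open>j\<close>, \<open>k\<close>, \<open>t\<close> decides. Pairing the
  relation with its own member \<open>r j\<close> exchanges \<open>k\<close> and \<open>l\<close> up
  to sign, \<open>pcomm_adjacent\<close> exchanges the two tetrahedra up to sign, and these moves
  reach every choice.\<close>

lemma isotropicI:
  assumes "distinct [i, j, k, t]" "r \<in> relations F i" "pcomm t (r j) (r k) = 0"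
  shows "isotropic i r"
proof -
  define P where "P j k t \<longleftrightarrow> pcomm t (r j) (r k) = 0" for j k t
  have swap: "P j k t \<longleftrightarrow> P k j t" for j k t
    unfolding P_def by (subst pcomm_swap) simp
  have edge: "P j k t \<longleftrightarrow> P j l t" if "distinct [i, j, k, l, t]" for j k l t
    using relations_pcomm[OF that assms(2), of "r j"] by (auto simp: P_def)
  have tet: "P j k t \<longleftrightarrow> P j k l" if "distinct [i, j, k, l, t]" for j k l t
  proof -
    have "r j \<in> edge_space F {i, j}" "r k \<in> edge_space F {i, k}"
      using that assms(2) by (auto intro: relations_edge)
    from pcomm_adjacent[OF that this] show ?thesis
      by (simp add: P_def)
  qed
  obtain l where l: "distinct [i, j, k, l, t]"
    using assms(1) by (rule distinct4_extend)
  have P: "P j k t"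
    using assms(3) by (simp add: P_def)
  have t: "P j k t" "P j l t" "P k l t"
    using P edge[of j k l t] edge[of k j l t] swap l by auto
  have "P j k l" "P j l k" "P k l j"
    using t tet[of j k l t] tet[of j l k t] tet[of k l j t] l by auto
  then have "P j t l" "P k t l" "P j t k" "P l t k" "P k t j" "P l t j"
    using edge[of j k t l] edge[of k j t l] edge[of j l t k] edge[of l j t k] edge[of k l t j]
      edge[of l k t j] swap l by auto
  \<comment> \<open>Up to \<open>swap\<close> these are all twelve cases: six pairs of edges at
    \<open>i\<close>, each in the two tetrahedra that contain both.\<close>
  note all = t this \<open>P j k l\<close> \<open>P j l k\<close> \<open>P k l j\<close>
  have "P j' k' t'" if "distinct [i, j', k', t']" for j' k' t'
  proof -
    have "j' \<in> {j, k, l, t}" "k' \<in> {j, k, l, t}" "t' \<in> {j, k, l, t}"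
      using that distinct5_UNIV[OF l] by auto
    then show ?thesis
      using that all swap by (elim insertE emptyE; simp)
  qed
  then show ?thesis
    by (simp add: isotropic_def P_def)
qed

text \<open>As \<open>p j = q i\<close>, the sums \<open>p k + p l\<close> and
  \<open>q k + q l\<close> pair equally in \<open>t\<close>. Pairing them with \<open>p k\<close>
  and with \<open>q k\<close>, where the opposite edges contribute nothing, identifies both sides
  with \<open>[p k, q k]\<close>.\<close>

lemma pcomm_across_edge:
  assumes "distinct [i, j, k, l, t]" "p \<in> relations F i" "q \<in> relations F j" "p j = q i"
  shows "pcomm t (p k) (p l) = - pcomm t (q k) (q l)"
proof -
  have "p k \<in> edge_space F {i, k}" "p l \<in> edge_space F {i, l}"
    "q k \<in> edge_space F {j, k}" "q l \<in> edge_space F {j, l}"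
    using assms by (auto intro!: relations_edge)
  then have "pcomm t (p k) (q l) = 0" "pcomm t (q k) (p l) = 0"
    using assms(1) pcomm_opposite[of i k j l t "p k" "q l"] pcomm_opposite[of j k i l t "q k" "p l"]
    by auto
  moreover have "pcomm t w (p k) + pcomm t w (p l) = pcomm t w (q k) + pcomm t w (q l)" for w
  proof -
    have "distinct [j, i, k, l, t]"
      using assms(1) by auto
    from relations_pcomm[OF assms(1,2), of w] relations_pcomm[OF this assms(3), of w] show ?thesis
      unfolding assms(4) by (metis add.assoc add_left_cancel)
  qed
  from this[of "p k"] this[of "q k"] have
    "pcomm t (p k) (p l) = pcomm t (p k) (q k) + pcomm t (p k) (q l)"
    "pcomm t (q k) (p k) + pcomm t (q k) (p l) = pcomm t (q k) (q l)"
    by simp_all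
  ultimately show ?thesis
    using pcomm_swap[of t "p k" "q k"] by simp
qed

lemma isotropic_across_edge:
  assumes "i \<noteq> j" "p \<in> relations F i" "q \<in> relations F j" "p j = q i" "isotropic i p"
  shows "isotropic j q"
proof -
  obtain k l t where "distinct [i, j, k, l, t]"
    using assms(1) by (rule distinct2_extend)
  moreover from this have "pcomm t (p k) (p l) = 0"
    using assms(5) by (auto simp: isotropic_def)
  ultimately show ?thesis
    using pcomm_across_edge[of i j k l t p q] assms by (intro isotropicI[of j k l t]) auto
qed

lemma isotropic_scale: "isotropic i r \<Longrightarrow> isotropic i (\<lambda>j. c *s r j)"
  by (auto simp: isotropic_def pcomm_scale_left pcomm_scale_right)

end

section \<open>Generic Lagrangian subspaces\<close>

text \<open>Both assumptions are consequences of linear systems over \<open>lag F\<close> having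
  only the trivial solution. The first makes evaluation of relations at an edge injective; the
  second keeps 1 and -1 from being eigenvalues of the holonomy of the single triangle
  \<open>012\<close>.\<close>

locale generic_lagrangian = lagrangian +
  assumes relation_unique: "\<And>i m r j. i \<noteq> m \<Longrightarrow> r \<in> relations F i \<Longrightarrow> r m = 0 \<Longrightarrow> r j = 0"
    and no_unit_holonomy: "\<And>p q r \<sigma>. p \<in> relations F 0 \<Longrightarrow> q \<in> relations F 1 \<Longrightarrow> r \<in> relations F 2 \<Longrightarrow>
      q 2 = r 1 \<Longrightarrow> r 0 = p 2 \<Longrightarrow> p 1 = \<sigma> *s q 0 \<Longrightarrow> \<sigma> = 1 \<or> \<sigma> = -1 \<Longrightarrow> q 0 = 0"
begin

text \<open>If \<open>d\<close> also vanishes on \<open>t\<close>, it belongs to the edge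
  \<open>it\<close> as well, so \<open>d\<close> and \<open>-d\<close> form a relation that is zero
  on the other edges at \<open>i\<close>.\<close>

lemma edge_component_inj:
  assumes "distinct [i, j, t]" "d \<in> edge_space F {i, j}" "component t d = 0"
  shows "d = 0"
proof -
  obtain k l where kl: "distinct [i, j, t, k, l]"
    using assms(1) by (rule distinct3_extend)
  define r where "r = (\<lambda>x. if x = j then d else if x = t then - d else 0)"
  have "r \<in> relations F i"
    using assms kl subspace_edge_space[of F] subspace_lag[of F]
    by (auto simp: relations_def r_def edge_space_iff distinct5_UNIV[OF kl] component_uminus
        vec.subspace_neg vec.subspace_0)
  moreover have "r k = 0" "r j = d" "i \<noteq> k"
    using kl by (auto simp: r_def)
  ultimately show ?thesis
    using relation_unique by metis
qed

text \<open>The difference \<open>d' - d\<close> vanishes on \<open>i\<close> and \<open>t\<close>,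
  hence is an edge operator of \<open>it\<close> and closes up a relation that is zero on the edge
  \<open>il\<close>.\<close>

lemma edge_component_disjoint:
  assumes "distinct [i, j, k, t]" "d \<in> edge_space F {i, j}" "d' \<in> edge_space F {i, k}"
    and "component t d = component t d'"
  shows "d = 0" "d' = 0"
proof -
  obtain l where l: "distinct [i, j, k, l, t]"
    using assms(1) by (rule distinct4_extend)
  define r where "r = (\<lambda>x. if x = j then d else if x = k then - d' else if x = t then d' - d else 0)"
  have "r \<in> relations F i"
    using assms l subspace_edge_space[of F] subspace_lag[of F]
    by (auto simp: relations_def r_def edge_space_iff distinct5_UNIV[OF l] component_uminus
        component_diff vec.subspace_neg vec.subspace_0 vec.subspace_diff)
  moreover have "r l = 0" "r j = d" "r k = - d'" "i \<noteq> l"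
    using l by (auto simp: r_def)
  ultimately have "r j = 0" "r k = 0"
    using relation_unique by metis+
  then show "d = 0" "d' = 0"
    using \<open>r j = d\<close> \<open>r k = - d'\<close> by auto
qed

text \<open>By \<open>edge_component_disjoint\<close> the sum of the two edge spaces is direct and
  embeds into the 4-dimensional space of \<open>t\<close>. Both summands have dimension at least 2,
  so all these bounds are equalities.\<close>

lemma
  assumes "distinct [i, j, k, t]"
  shows dim_edge_space_aux: "vec.dim (edge_space F {i, j}) = 2"
    and edge_spaces_span:
      "\<exists>d\<in>edge_space F {i, j}. \<exists>d'\<in>edge_space F {i, k}. component t w = component t (d + d')"
proof -
  let ?S = "edge_space F {i, j}" and ?T = "edge_space F {i, k}"
  let ?sum = "{d + d' |d d'. d \<in> ?S \<and> d' \<in> ?T}"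
  let ?W = "{d :: opr. \<forall>g. g \<notin> {g. gen_tet g = t} \<longrightarrow> d $ g = 0}"
  have sub: "vec.subspace ?S" "vec.subspace ?T" "vec.subspace ?W"
    using subspace_edge_space by (auto simp: vec.subspace_def)
  have sum: "vec.subspace ?sum"
    using sub by (simp add: vec.subspace_sums)
  have "?S \<inter> ?T = {0}"
    using edge_component_disjoint(1)[OF assms] sub(1,2) by (auto intro: vec.subspace_0)
  then have dim_sum: "vec.dim ?sum = vec.dim ?S + vec.dim ?T"
    using vec.dim_sums_Int[OF sub(1,2)] by simp
  have lin: "Vector_Spaces.linear (*s) (*s) (component t)"
    by unfold_locales (simp_all add: component_add component_scale vec_eq_iff algebra_simps)
  have "d + d' = e + e'" if "d \<in> ?S" "d' \<in> ?T" "e \<in> ?S" "e' \<in> ?T"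
    "component t (d + d') = component t (e + e')" for d d' e e'
  proof -
    have "component t (d - e) = component t (e' - d')"
      using that(5) by (simp add: component_add component_diff algebra_simps)
    then have "d - e = 0" "e' - d' = 0"
      using edge_component_disjoint[OF assms, of "d - e" "e' - d'"] vec.subspace_diff[OF sub(1)]
        vec.subspace_diff[OF sub(2)] that(1-4) by blast+
    then show ?thesis
      by simp
  qed
  then have "inj_on (component t) ?sum"
    by (fastforce simp: inj_on_def)
  then have dim_image: "vec.dim (component t ` ?sum) = vec.dim ?sum"
    using sum by (intro vec.dim_image_eq[OF lin]) (simp add: vec.span_eq_iff[THEN iffD2])
  have dim_W: "vec.dim ?W = 4"
    unfolding dim_substandard_cart by (rule card_gens_of_tet)
  have image: "component t ` ?sum \<subseteq> ?W"
    by auto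
  have "vec.dim ?S + vec.dim ?T \<le> 4"
    using vec.dim_subset[OF image] by (simp only: dim_image dim_sum dim_W)
  moreover have "2 \<le> vec.dim ?S" "2 \<le> vec.dim ?T"
    using assms by (auto intro: dim_edge_space_ge)
  ultimately have dims: "vec.dim ?S = 2" "vec.dim ?T = 2"
    by auto
  show "vec.dim ?S = 2"
    by (rule dims)
  have "vec.dim ?W \<le> vec.dim (component t ` ?sum)"
    unfolding dim_image dim_sum dim_W dims by simp
  then have "component t ` ?sum = ?W"
    by (rule vec.subspace_dim_equal[OF vec.linear_subspace_image[OF lin sum] sub(3) image])
  moreover have "component t w \<in> ?W"
    by auto
  ultimately show "\<exists>d\<in>?S. \<exists>d'\<in>?T. component t w = component t (d + d')"
    by blast
qed

lemma dim_edge_space: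
  assumes "i \<noteq> j"
  shows "vec.dim (edge_space F {i, j}) = 2"
proof -
  obtain k l m where "distinct [i, j, k, l, m]"
    using assms(1) by (rule distinct2_extend)
  then show ?thesis
    by (intro dim_edge_space_aux[of i j k l]) auto
qed

text \<open>On the tetrahedron \<open>l\<close>, the component of \<open>d\<close> is matched by
  edge operators \<open>x\<close>, \<open>y\<close> of \<open>ik\<close> and \<open>im\<close>; the
  remainder \<open>x + y - d\<close> then vanishes on \<open>i\<close> and \<open>l\<close> and
  belongs to the edge \<open>il\<close>.\<close>

lemma relation_exists:
  assumes "i \<noteq> j" "d \<in> edge_space F {i, j}"
  obtains r where "r \<in> relations F i" "r j = d"
proof -
  obtain k l m where d: "distinct [i, j, k, l, m]"
    using assms(1) by (rule distinct2_extend)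
  have "distinct [i, k, m, l]"
    using d by auto
  from edge_spaces_span[OF this, of d] obtain x y where xy:
    "x \<in> edge_space F {i, k}" "y \<in> edge_space F {i, m}" "component l d = component l (x + y)"
    by blast
  define r where "r = (\<lambda>v. if v = j then d else if v = k then - x else if v = m then - y
    else if v = l then x + y - d else 0)"
  have "r \<in> relations F i"
    using d xy assms subspace_lag[of F]
    by (auto simp: relations_def r_def edge_space_iff distinct5_UNIV[OF d] component_uminus
        component_diff component_add vec.subspace_0 vec.subspace_neg vec.subspace_diff
        vec.subspace_add)
  moreover have "r j = d"
    by (simp add: r_def)
  ultimately show thesis ..
qed

text \<open>The edges \<open>ki\<close> and \<open>kl\<close> together span the space of
  \<open>t\<close>. The second is opposite to \<open>ij\<close>, so orthogonality to the first puts
  the component of \<open>w\<close> into the radical of the symplectic form.\<close>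

lemma pcomm_edges_nondegenerate:
  assumes "distinct [i, j, k, t]" "w \<in> edge_space F {i, j}"
    and orth: "\<And>d. d \<in> edge_space F {i, k} \<Longrightarrow> pcomm t w d = 0"
  shows "w = 0"
proof -
  obtain l where l: "distinct [i, j, k, l, t]"
    using assms(1) by (rule distinct4_extend)
  have "pcomm t w u = 0" for u
  proof -
    have "distinct [k, i, l, t]"
      using l by auto
    from edge_spaces_span[OF this, of u] obtain x y where xy:
      "x \<in> edge_space F {k, i}" "y \<in> edge_space F {k, l}" "component t u = component t (x + y)"
      by (elim bexE)
    have "pcomm t w y = 0"
      using l assms(2) xy(2) by (rule pcomm_opposite)
    moreover have "pcomm t w x = 0"
      using xy(1) by (intro orth) (simp add: insert_commute)
    moreover have "pcomm t w u = pcomm t w (x + y)"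
      by (rule pcomm_cong_right) (rule xy(3))
    ultimately show ?thesis
      by (simp only: pcomm_add_right add_0_left)
  qed
  then have "component t w = 0"
    by (rule pcomm_nondegenerate)
  moreover have "distinct [i, j, t]"
    using assms(1) by simp
  ultimately show ?thesis
    by (intro edge_component_inj[OF _ assms(2)])
qed

lemma edge_space_span_pair:
  assumes "i \<noteq> j" "e \<in> edge_space F {i, j}" "f \<in> edge_space F {i, j}" "e \<noteq> 0" "\<nexists>c. f = c *s e"
  shows "e \<noteq> f \<and> vec.independent {e, f} \<and> vec.span {e, f} = edge_space F {i, j}"
proof -
  have "f \<notin> vec.span {e}"
    using assms(5) by (auto simp: vec.span_singleton)
  then have "e \<noteq> f" and indep: "vec.independent {e, f}"
    using assms(4) vec.span_base[of f "{f}"] by (auto simp: insert_commute[of e] vec.independent_insert)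
  moreover have "edge_space F {i, j} \<subseteq> vec.span {e, f}"
    using assms indep \<open>e \<noteq> f\<close> dim_edge_space[OF assms(1)]
    by (intro vec.card_ge_dim_independent) auto
  moreover have "vec.span {e, f} \<subseteq> edge_space F {i, j}"
    using assms subspace_edge_space by (intro vec.span_minimal) auto
  ultimately show ?thesis
    by blast
qed

text \<open>In other words, an isotropic relation at \<open>i\<close> is an eigenvector of the holonomy of every triangle at \<open>i\<close>.\<close>

lemma isotropic_eigenvector:
  assumes d: "distinct [i, j, k]" and p: "p \<in> relations F i" "isotropic i p" "p j \<noteq> 0"
    and q: "q \<in> relations F j" "q i = p j" and r: "r \<in> relations F k" "r i = p k"
  obtains c where "c \<noteq> 0" "q k = c *s r j"
proof -
  obtain l t where lt: "distinct [i, j, k, l, t]"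
    using d by (rule distinct3_extend)
  have edges: "p j \<in> edge_space F {i, j}" "p k \<in> edge_space F {i, k}"
    "q k \<in> edge_space F {j, k}" "r j \<in> edge_space F {k, j}"
    using d p q r by (auto intro: relations_edge)
  have "pcomm t (p j) (p k) = 0"
    using p(2) lt by (auto simp: isotropic_def)
  then have "pcomm t (p j) (r j) = 0" "pcomm t (p k) (q k) = 0"
    using relations_triangle[of k i j t r "p j"] relations_triangle[of j i k t q "p k"] edges lt q r
      pcomm_swap[of t "p k" "p j"] by auto
  moreover have "pcomm t (q k) (p k) = - pcomm t (q k) (p j)"
    using lt p edges by (intro relations_triangle[of i]) auto
  ultimately have orth: "pcomm t (p j) (r j) = 0" "pcomm t (p j) (q k) = 0"
    using pcomm_swap[of t "p j" "q k"] pcomm_swap[of t "p k" "q k"] by auto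
  have "p k \<noteq> 0"
    using relation_unique[of i k p j] p d by auto
  then have nonzero: "r j \<noteq> 0" "q k \<noteq> 0"
    using relation_unique[of k j r i] relation_unique[of j k q i] q r p d by auto
  \<comment> \<open>Both \<open>r j\<close> and \<open>q k\<close> are orthogonal to
    \<open>p j\<close>. Were they independent, they would span the edge space of \<open>jk\<close>,
    contradicting \<open>pcomm_edges_nondegenerate\<close>.\<close>
  have "\<exists>c. q k = c *s r j"
  proof (rule ccontr)
    assume "\<nexists>c. q k = c *s r j"
    then have span: "vec.span {r j, q k} = edge_space F {j, k}"
      using edge_space_span_pair[of j k "r j" "q k"] edges nonzero d by (simp add: insert_commute)
    have "pcomm t (p j) x = 0" if "x \<in> edge_space F {j, k}" for x
    proof -
      have "x \<in> vec.span {r j, q k}"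
        using that span by simp
      then obtain a b where "x = a *s r j + b *s q k"
        by (auto simp: vec.span_insert vec.span_singleton algebra_simps)
      then show ?thesis
        by (simp add: pcomm_add_right pcomm_scale_right orth)
    qed
    then have "p j = 0"
      using lt edges by (intro pcomm_edges_nondegenerate[of j i k t]) (auto simp: insert_commute)
    with p(3) show False ..
  qed
  then show thesis
    using that nonzero by auto
qed

end

section \<open>Bases of edge spaces and holonomy\<close>

lemma independent_pair_zero:
  assumes "vec.independent {e, f :: 'a::field^'n}" "e \<noteq> f" "a *s e + b *s f = 0"
  shows "a = 0" "b = 0"
proof -
  have indep: "vec.independent {f, e}"
    using assms(1) by (simp add: insert_commute)
  then have "f \<notin> vec.span {e}" "e \<noteq> 0"
    using assms(2) by (auto simp: vec.independent_insert)
  show "b = 0"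
  proof (rule ccontr)
    assume "b \<noteq> 0"
    have "f = inverse b *s (b *s f)"
      using \<open>b \<noteq> 0\<close> by simp
    also have "b *s f = (- a) *s e"
      using assms(3) by (simp add: eq_neg_iff_add_eq_0 add.commute)
    finally have "f \<in> vec.span {e}"
      by (metis singletonI vec.span_base vec.span_scale)
    then show False
      using \<open>f \<notin> vec.span {e}\<close> by contradiction
  qed
  then show "a = 0"
    using assms(3) \<open>e \<noteq> 0\<close> by simp
qed

lemma det_eq_0_kernel:
  fixes A :: "'a::field^'n^'n"
  assumes "det A = 0"
  obtains x where "x \<noteq> 0" "A *v x = 0"
proof -
  have "\<not> invertible A"
    using assms by (simp add: invertible_det_nz)
  then show thesis
    using that by (metis invertible_left_inverse matrix_left_invertible_ker)
qed

lemma matrix_inv_cancel: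
  fixes A :: "'a::semiring_1^'n^'n"
  assumes "invertible A"
  shows "A ** matrix_inv A = mat 1" "matrix_inv A ** A = mat 1"
  using someI_ex[OF assms[unfolded invertible_def]] by (simp_all add: matrix_inv_def)

lemma det_matrix_inv:
  fixes A :: "'a::field^'n^'n"
  assumes "invertible A"
  shows "det (matrix_inv A) = inverse (det A)"
proof -
  have "det A * det (matrix_inv A) = 1"
    using assms by (simp add: matrix_inv_cancel flip: det_mul)
  then show ?thesis
    by (simp add: inverse_unique)
qed

definition comb :: "opr \<Rightarrow> opr \<Rightarrow> complex^2 \<Rightarrow> opr" where
  "comb e f c = c $ 1 *s e + c $ 2 *s f"

lemma comb_scale: "comb e f (a *s c) = a *s comb e f c"
  by (simp add: comb_def vec.scale_right_distrib)

lemma comb_add: "comb e f (c + d) = comb e f c + comb e f d"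
  by (simp add: comb_def vec.scale_left_distrib algebra_simps)

lemma comb_zero [simp]: "comb e f 0 = 0"
  by (simp add: comb_def)

lemma span_pair_eq_comb: "vec.span {e, f} = range (comb e f)"
proof (intro equalityI subsetI)
  fix d assume "d \<in> vec.span {e, f}"
  then obtain a b where "d = a *s e + b *s f"
    by (auto simp: vec.span_insert vec.span_singleton algebra_simps)
  then have "d = comb e f (\<chi> r. if r = 1 then a else b)"
    by (simp add: comb_def)
  then show "d \<in> range (comb e f)"
    by blast
next
  fix d assume "d \<in> range (comb e f)"
  then show "d \<in> vec.span {e, f}"
    by (auto simp: comb_def intro!: vec.span_add vec.span_scale intro: vec.span_base)
qed

lemma comb_eq_0_iff:
  assumes "vec.independent {e, f}" "e \<noteq> f"
  shows "comb e f c = 0 \<longleftrightarrow> c = 0"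
proof
  assume "comb e f c = 0"
  then have "c $ 1 = 0" "c $ 2 = 0"
    using independent_pair_zero[OF assms] unfolding comb_def by blast+
  then show "c = 0"
    by (simp add: vec_eq_iff forall_2)
qed simp

lemma vector_matrix_mult_2:
  "((c :: complex^2) v* M) $ s = c $ 1 * M $ 1 $ s + c $ 2 * M $ 2 $ s"
  by (simp add: vector_matrix_mult_def sum_2 mult.commute)

text \<open>Coordinates of edge operators are row vectors, hence eigenvectors are taken on the left.
  The quadratic is the characteristic polynomial.\<close>

lemma left_eigenvector_iff:
  fixes M :: "complex^2^2"
  assumes "det M = 1"
  shows "(\<exists>c. c \<noteq> 0 \<and> c v* M = \<mu> *s c) \<longleftrightarrow> \<mu>\<^sup>2 - (M $ 1 $ 1 + M $ 2 $ 2) * \<mu> + 1 = 0"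
proof -
  define N :: "complex^2^2" where "N = transpose M - mat \<mu>"
  have "c v* M = \<mu> *s c \<longleftrightarrow> N *v c = 0" for c
  proof -
    have "N *v c = c v* M - \<mu> *s c"
      by (simp add: N_def matrix_vector_mult_def vector_matrix_mult_def vec_eq_iff sum_2 forall_2
          mat_def transpose_def algebra_simps)
    then show ?thesis
      by simp
  qed
  then have "(\<exists>c. c \<noteq> 0 \<and> c v* M = \<mu> *s c) \<longleftrightarrow> (\<exists>c. c \<noteq> 0 \<and> N *v c = 0)"
    by simp
  also have "\<dots> \<longleftrightarrow> det N = 0"
    by (metis det_eq_0_kernel invertible_det_nz invertible_left_inverse matrix_left_invertible_ker)
  also have "det N = \<mu>\<^sup>2 - (M $ 1 $ 1 + M $ 2 $ 2) * \<mu> + det M"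
    by (simp add: N_def det_2 mat_def transpose_def power2_eq_square algebra_simps)
  finally show ?thesis
    by (simp add: assms)
qed

text \<open>The roots of \<open>x\<^sup>2 - t * x + 1\<close> are \<open>\<mu>\<close> and
  \<open>t - \<mu>\<close>, with product 1; for a double root both names denote the same
  number.\<close>

lemma left_eigenvalues:
  fixes M :: "complex^2^2"
  assumes "det M = 1"
  obtains \<mu> where "\<mu> \<noteq> 0" "{x. \<exists>c. c \<noteq> 0 \<and> c v* M = x *s c} = {\<mu>, inverse \<mu>}"
proof -
  define t where "t = M $ 1 $ 1 + M $ 2 $ 2"
  define \<mu> where "\<mu> = (t + csqrt (t\<^sup>2 - 4)) / 2"
  have "2 * \<mu> - t = csqrt (t\<^sup>2 - 4)"
    by (simp add: \<mu>_def field_simps)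
  then have "(2 * \<mu> - t)\<^sup>2 = t\<^sup>2 - 4"
    by simp
  moreover have "4 * (\<mu> * (t - \<mu>)) = t\<^sup>2 - (2 * \<mu> - t)\<^sup>2"
    by (simp add: power2_eq_square algebra_simps)
  ultimately have prod: "\<mu> * (t - \<mu>) = 1"
    by simp
  then have inv: "inverse \<mu> = t - \<mu>" and "\<mu> \<noteq> 0"
    by (auto simp: inverse_unique)
  have "x\<^sup>2 - t * x + 1 = (x - \<mu>) * (x - (t - \<mu>))" for x
    using prod by (simp add: power2_eq_square algebra_simps)
  then have "{x. \<exists>c. c \<noteq> 0 \<and> c v* M = x *s c} = {\<mu>, inverse \<mu>}"
    unfolding left_eigenvector_iff[OF assms] inv t_def[symmetric] by auto
  then show thesis
    using that \<open>\<mu> \<noteq> 0\<close> by blast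
qed

lemma maps_basis_exists:
  assumes "vec.independent {e, f}" "e \<noteq> f" "det M = 1"
  shows "\<exists>\<phi>. maps_basis e f M \<phi> \<and> bij_betw \<phi> (vec.span {e, f}) (vec.span {e, f}) \<and>
    (\<exists>\<mu>. \<mu> \<noteq> 0 \<and> eigenvalues_on (vec.span {e, f}) \<phi> = {\<mu>, inverse \<mu>})"
proof -
  obtain \<phi> where lin: "Vector_Spaces.linear (*s) (*s) \<phi>"
    and \<phi>: "\<forall>x\<in>{e, f}. \<phi> x = (if x = e then comb e f (M $ 1) else comb e f (M $ 2))"
    using vec.linear_independent_extend[OF assms(1),
        of "\<lambda>x. if x = e then comb e f (M $ 1) else comb e f (M $ 2)"] by blast
  interpret Vector_Spaces.linear "(*s)" "(*s)" \<phi>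
    by (rule lin)
  have maps: "maps_basis e f M \<phi>"
    using lin \<phi> assms(2) by (auto simp: maps_basis_def comb_def)
  have \<phi>_comb: "\<phi> (comb e f c) = comb e f (c v* M)" for c
    using \<phi> assms(2)
    by (simp add: comb_def add scale vector_matrix_mult_2 vec.scale_left_distrib
        vec.scale_right_distrib algebra_simps)
  have comb_inj: "comb e f c = comb e f d \<longleftrightarrow> c = d" for c d
    using comb_eq_0_iff[OF assms(1,2), of "c - d"] comb_add[of e f "c - d" d] by auto
  have "invertible M"
    using assms(3) by (simp add: invertible_det_nz)
  then have inv: "c v* M v* matrix_inv M = c" "c v* matrix_inv M v* M = c" for c
    by (simp_all add: vector_matrix_mul_assoc matrix_inv_cancel)
  have "bij_betw \<phi> (range (comb e f)) (range (comb e f))"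
    unfolding bij_betw_def
  proof
    show "inj_on \<phi> (range (comb e f))"
      by (auto simp: inj_on_def \<phi>_comb comb_inj) (metis inv(1))
    show "\<phi> ` range (comb e f) = range (comb e f)"
      by (auto simp: image_iff \<phi>_comb) (metis inv(2))
  qed
  moreover have "eigenvalues_on (range (comb e f)) \<phi> = {x. \<exists>c. c \<noteq> 0 \<and> c v* M = x *s c}"
  proof -
    have "\<phi> (comb e f c) = x *s comb e f c \<longleftrightarrow> c v* M = x *s c" for x c
      unfolding \<phi>_comb comb_scale[symmetric] by (rule comb_inj)
    then show ?thesis
      by (simp add: eigenvalues_on_def comb_eq_0_iff[OF assms(1,2)])
  qed
  moreover obtain \<mu> where "\<mu> \<noteq> 0" "{x. \<exists>c. c \<noteq> 0 \<and> c v* M = x *s c} = {\<mu>, inverse \<mu>}"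
    using assms(3) by (rule left_eigenvalues)
  ultimately show ?thesis
    unfolding span_pair_eq_comb using maps by (intro exI[of _ \<phi>] conjI exI[of _ \<mu>]) simp_all
qed

section \<open>From the matrices \<open>A i j\<close> to families in
  \<open>relations\<close>\<close>

definition row_relation ::
  "(vertex set \<Rightarrow> opr) \<Rightarrow> (vertex set \<Rightarrow> opr) \<Rightarrow> (vertex \<Rightarrow> vertex \<Rightarrow> complex^2^2) \<Rightarrow> vertex \<Rightarrow>
    complex^2 \<Rightarrow> vertex \<Rightarrow> opr" where
  "row_relation e f A i c j = (if j = i then 0 else comb (e {i, j}) (f {i, j}) (c v* A i j))"

lemma edge_basesD:
  assumes "edge_bases F e f" "i \<noteq> j"
  shows "e {i, j} \<noteq> f {i, j}" "vec.independent {e {i, j}, f {i, j}}"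
    "vec.span {e {i, j}, f {i, j}} = edge_space F {i, j}"
    "e {i, j} \<in> edge_space F {i, j}" "f {i, j} \<in> edge_space F {i, j}"
proof -
  have "{i, j} \<in> edges"
    using assms(2) by (simp add: edges_def)
  then show "e {i, j} \<noteq> f {i, j}" "vec.independent {e {i, j}, f {i, j}}"
    and span: "vec.span {e {i, j}, f {i, j}} = edge_space F {i, j}"
    using assms(1) by (auto simp: edge_bases_def)
  show "e {i, j} \<in> edge_space F {i, j}" "f {i, j} \<in> edge_space F {i, j}"
    unfolding span[symmetric] by (auto intro: vec.span_base)
qed

lemma comb_in_edge_space:
  assumes "edge_bases F e f" "i \<noteq> j"
  shows "comb (e {i, j}) (f {i, j}) c \<in> edge_space F {i, j}"
  unfolding edge_basesD(3)[OF assms, symmetric] span_pair_eq_comb by blast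

lemma row_relation:
  assumes "edge_bases F e f" "edge_relations e f A"
  shows "row_relation e f A i c \<in> relations F i"
proof -
  have "(\<Sum>j\<in>UNIV. row_relation e f A i c j) =
      (\<Sum>j\<in>UNIV - {i}. comb (e {i, j}) (f {i, j}) (c v* A i j))"
    by (intro sum.mono_neutral_cong_right) (auto simp: row_relation_def)
  also have "\<dots> = (\<Sum>j\<in>UNIV - {i}. c $ 1 *s comb (e {i, j}) (f {i, j}) (A i j $ 1) +
      c $ 2 *s comb (e {i, j}) (f {i, j}) (A i j $ 2))"
    by (intro sum.cong refl)
       (simp add: comb_def vector_matrix_mult_2 vec.scale_left_distrib vec.scale_right_distrib)
  also have "\<dots> = c $ 1 *s (\<Sum>j\<in>UNIV - {i}. comb (e {i, j}) (f {i, j}) (A i j $ 1)) +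
      c $ 2 *s (\<Sum>j\<in>UNIV - {i}. comb (e {i, j}) (f {i, j}) (A i j $ 2))"
    by (simp add: sum.distrib vec.scale_sum_right)
  also have "\<dots> = 0"
    using assms(2) by (simp add: edge_relations_def comb_def)
  finally show ?thesis
    using comb_in_edge_space[OF assms(1), of i]
    by (auto simp: relations_def row_relation_def)
qed

text \<open>Turns an eigenvector of the triangle matrix into three relations that agree along two
  edges and differ by \<open>\<mu>\<close> along the third, the form that
  \<open>holonomy_isotropic\<close> expects.\<close>

lemma row_relation_eigen:
  assumes "edge_bases F e f" "edge_relations e f A" "distinct [i, j, k]"
    and c: "c v* triangle_matrix A i j k = \<mu> *s c"
  obtains p q r where "p \<in> relations F i" "q \<in> relations F j" "r \<in> relations F k"
    "q i = comb (e {i, j}) (f {i, j}) c" "q k = r j" "r i = p k" "p j = \<mu> *s q i"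
proof -
  \<comment> \<open>Transport around the triangle: \<open>cq\<close> describes the relation at
    \<open>j\<close> with value \<open>c\<close> on \<open>ij\<close>, \<open>cr\<close> the one at
    \<open>k\<close> agreeing with it on \<open>jk\<close>, and \<open>cp\<close> the one at
    \<open>i\<close> agreeing with that on \<open>ki\<close>.\<close>
  define cq where "cq = c v* matrix_inv (A j i)"
  define cr where "cr = cq v* A j k v* matrix_inv (A k j)"
  define cp where "cp = cr v* A k i v* matrix_inv (A i k)"
  have inv: "x v* matrix_inv (A i j) v* A i j = x" if "i \<noteq> j" for x i j
    using assms(2) that by (simp add: edge_relations_def vector_matrix_mul_assoc matrix_inv_cancel)
  have "cp v* A i j = \<mu> *s c"
    unfolding cp_def cr_def cq_def c[symmetric] triangle_matrix_def
    by (simp add: vector_matrix_mul_assoc matrix_mul_assoc)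
  moreover have "cq v* A j i = c" "cr v* A k j = cq v* A j k" "cp v* A i k = cr v* A k i"
    using assms(3) by (auto simp: cq_def cr_def cp_def intro!: inv)
  moreover have "j \<noteq> i" "k \<noteq> i" "k \<noteq> j"
    using assms(3) by auto
  ultimately show thesis
    using that[of "row_relation e f A i cp" "row_relation e f A j cq" "row_relation e f A k cr"]
      row_relation[OF assms(1,2)] assms(3)
    by (simp add: row_relation_def insert_commute comb_scale)
qed

section \<open>Gram determinants and the determinant of the holonomy\<close>

definition gram ::
  "(vertex set \<Rightarrow> opr) \<Rightarrow> (vertex set \<Rightarrow> opr) \<Rightarrow> vertex \<Rightarrow> vertex set \<Rightarrow> vertex set \<Rightarrow> complex^2^2" where
  "gram e f t b b' = (\<chi> r s. pcomm t (if r = 1 then e b else f b) (if s = 1 then e b' else f b'))"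

text \<open>Exchanging the edges transposes and negates the matrix; neither changes a determinant of
  size 2.\<close>

lemma det_gram_commute: "det (gram e f t b' b) = det (gram e f t b b')"
  using pcomm_swap[of t "e b'" "e b"] pcomm_swap[of t "e b'" "f b"] pcomm_swap[of t "f b'" "e b"]
    pcomm_swap[of t "f b'" "f b"]
  by (simp add: det_2 gram_def)

context lagrangian
begin

text \<open>This is \<open>relations_triangle\<close> in matrix form, applied to both rows of the
  relation at \<open>i\<close>; the sign disappears in a determinant of size 2.\<close>

lemma det_gram_triangle:
  assumes "edge_bases F e f" "edge_relations e f A" "distinct [i, j, k, t]"
  shows "det (gram e f t {j, k} {i, k}) * det (A i k) = det (gram e f t {j, k} {i, j}) * det (A i j)"
proof -
  have jk: "e {j, k} \<in> edge_space F {j, k}" "f {j, k} \<in> edge_space F {j, k}"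
    using assms(3) edge_basesD(4,5)[OF assms(1), of j k] by auto
  have "pcomm t d (comb (e {i, k}) (f {i, k}) (A i k $ s)) =
      - pcomm t d (comb (e {i, j}) (f {i, j}) (A i j $ s))" if d: "d \<in> edge_space F {j, k}" for d s
  proof -
    have "A i l $ s = axis s 1 v* A i l" for l
      by (simp add: vec_eq_iff vector_matrix_mult_def axis_def if_distrib[of "\<lambda>x. x * _"]
          cong: if_cong)
    then show ?thesis
      using relations_triangle[OF assms(3) row_relation[OF assms(1,2), of i "axis s 1"] d] assms(3)
      by (auto simp: row_relation_def)
  qed
  from this[OF jk(1)] this[OF jk(2)]
  have "gram e f t {j, k} {i, k} ** transpose (A i k) =
      - (gram e f t {j, k} {i, j} ** transpose (A i j))"
    by (simp add: vec_eq_iff forall_2 matrix_matrix_mult_def sum_2 gram_def transpose_def comb_def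
        pcomm_add_right pcomm_scale_right mult.commute)
  then have "det (gram e f t {j, k} {i, k} ** transpose (A i k)) =
      det (gram e f t {j, k} {i, j} ** transpose (A i j))"
    by (simp add: det_2)
  then show ?thesis
    by (simp add: det_mul det_transpose)
qed

end

context generic_lagrangian
begin

text \<open>A kernel vector would be an edge operator of \<open>ik\<close> orthogonal to the whole
  edge space of \<open>ij\<close>.\<close>

lemma det_gram_nonzero:
  assumes "edge_bases F e f" "distinct [i, j, k, t]"
  shows "det (gram e f t {i, j} {i, k}) \<noteq> 0"
proof
  assume "det (gram e f t {i, j} {i, k}) = 0"
  then obtain c where c: "c \<noteq> 0" "gram e f t {i, j} {i, k} *v c = 0"
    by (rule det_eq_0_kernel)
  define w where "w = comb (e {i, k}) (f {i, k}) c"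
  note bases = edge_basesD[OF assms(1), of i k] edge_basesD[OF assms(1), of i j]
  have w: "w \<in> edge_space F {i, k}"
    using assms(2) by (auto simp: w_def intro: comb_in_edge_space[OF assms(1)])
  have "pcomm t (e {i, j}) w = 0" "pcomm t (f {i, j}) w = 0"
    using c(2) by (simp_all add: vec_eq_iff forall_2 matrix_vector_mult_def sum_2 gram_def w_def
        comb_def pcomm_add_right pcomm_scale_right mult.commute)
  then have "pcomm t w (e {i, j}) = 0" "pcomm t w (f {i, j}) = 0"
    using pcomm_swap[of t w] by simp_all
  then have "pcomm t w (comb (e {i, j}) (f {i, j}) c) = 0" for c
    by (simp add: comb_def pcomm_add_right pcomm_scale_right)
  moreover have "edge_space F {i, j} = range (comb (e {i, j}) (f {i, j}))"
    using bases(8) assms(2) by (simp add: span_pair_eq_comb)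
  ultimately have "pcomm t w d = 0" if "d \<in> edge_space F {i, j}" for d
    using that by auto
  then have "w = 0"
    using assms(2) w by (intro pcomm_edges_nondegenerate[of i k j t]) auto
  then show False
    using c(1) comb_eq_0_iff[OF bases(2,1)] assms(2) by (simp add: w_def)
qed

lemma det_triangle_matrix:
  assumes "edge_bases F e f" "edge_relations e f A" "distinct [i, j, k]"
  shows "det (triangle_matrix A i j k) = 1"
proof -
  obtain l t where d: "distinct [i, j, k, l, t]"
    using assms(3) by (rule distinct3_extend)
  then have d': "distinct [i, j, k, t]" "distinct [j, i, k, t]" "distinct [k, i, j, t]"
    by auto
  \<comment> \<open>One Gram determinant per vertex of the triangle, for the two edges meeting
    there. Each of the facts 1, 2, 3 relates two of them, and in the product of the three all
    cancel.\<close>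
  define x y z where "x = det (gram e f t {i, j} {i, k})" and "y = det (gram e f t {j, i} {j, k})"
    and "z = det (gram e f t {k, i} {k, j})"
  have "x \<noteq> 0" "y \<noteq> 0" "z \<noteq> 0"
    unfolding x_def y_def z_def using d by (auto intro!: det_gram_nonzero[OF assms(1)])
  have 1: "z * det (A i k) = y * det (A i j)"
    using det_gram_triangle[OF assms(1,2) d'(1)] det_gram_commute[of e f t]
    by (simp add: y_def z_def insert_commute)
  have 2: "z * det (A j k) = x * det (A j i)"
    using det_gram_triangle[OF assms(1,2) d'(2)] det_gram_commute[of e f t]
    by (simp add: x_def z_def insert_commute)
  have 3: "y * det (A k j) = x * det (A k i)"
    using det_gram_triangle[OF assms(1,2) d'(3)] det_gram_commute[of e f t]
    by (simp add: x_def y_def insert_commute)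
  have inv: "invertible (A a b)" if "a \<noteq> b" for a b
    using assms(2) that by (simp add: edge_relations_def)
  then have invs: "invertible (A j i)" "invertible (A k j)" "invertible (A i k)"
    using assms(3) by auto
  then have nz: "det (A j i) \<noteq> 0" "det (A k j) \<noteq> 0" "det (A i k) \<noteq> 0"
    by (simp_all flip: invertible_det_nz)
  have "(x * y * z) * (det (A i j) * det (A j k) * det (A k i)) =
      (y * det (A i j)) * (z * det (A j k)) * (x * det (A k i))"
    by simp
  also have "\<dots> = (x * y * z) * (det (A i k) * det (A j i) * det (A k j))"
    by (simp add: 1[symmetric] 2 3[symmetric])
  finally have "det (A i j) * det (A j k) * det (A k i) = det (A i k) * det (A j i) * det (A k j)"
    using \<open>x \<noteq> 0\<close> \<open>y \<noteq> 0\<close> \<open>z \<noteq> 0\<close> by simp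
  then show ?thesis
    using invs nz by (simp add: triangle_matrix_def det_mul det_matrix_inv field_simps)
qed

end

section \<open>Diagonal relations\<close>

context lagrangian
begin

text \<open>The coordinates of two relations per vertex serve as the rows of the matrices;
  independence on each edge is what makes them invertible.\<close>

lemma edge_relations_of_families:
  assumes bases: "edge_bases F e f"
    and rel: "\<And>i. p i \<in> relations F i" "\<And>i. q i \<in> relations F i"
    and indep: "\<And>i j a b. i \<noteq> j \<Longrightarrow> a *s p i j + b *s q i j = 0 \<Longrightarrow> a = 0 \<and> b = 0"
    and A: "\<And>i j. i \<noteq> j \<Longrightarrow> p i j = comb (e {i, j}) (f {i, j}) (A i j $ 1)"
      "\<And>i j. i \<noteq> j \<Longrightarrow> q i j = comb (e {i, j}) (f {i, j}) (A i j $ 2)"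
  shows "edge_relations e f A"
  unfolding edge_relations_def
proof (intro conjI allI impI)
  fix i j :: vertex assume "i \<noteq> j"
  have "x = 0" if "transpose (A i j) *v x = 0" for x
  proof -
    have "x v* A i j = 0"
      using that by simp
    then have "comb (e {i, j}) (f {i, j}) (x v* A i j) = 0"
      by simp
    then have "x $ 1 *s p i j + x $ 2 *s q i j = 0"
      using \<open>i \<noteq> j\<close>
      by (simp add: A comb_def vector_matrix_mult_2 vec.scale_left_distrib vec.scale_right_distrib
          add_ac)
    then show "x = 0"
      using indep[OF \<open>i \<noteq> j\<close>, of "x $ 1" "x $ 2"] by (simp add: vec_eq_iff forall_2)
  qed
  then have "invertible (transpose (A i j))"
    by (simp add: invertible_left_inverse matrix_left_invertible_ker)
  then show "invertible (A i j)"
    by (simp add: invertible_det_nz det_transpose)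
next
  fix i :: vertex and r :: 2
  have sum: "(\<Sum>j\<in>UNIV - {i}. s j) = 0" if "s \<in> relations F i" for s
    using that by (simp add: relations_def sum_diff1)
  have "(\<Sum>j\<in>UNIV - {i}. comb (e {i, j}) (f {i, j}) (A i j $ r)) = 0"
  proof (cases "r = 1")
    case True
    then show ?thesis
      using sum[OF rel(1)] by (simp add: A)
  next
    case False
    then have "r = 2"
      using exhaust_2[of r] by auto
    then show ?thesis
      using sum[OF rel(2)] by (simp add: A)
  qed
  then show "(\<Sum>j\<in>UNIV - {i}. A i j $ r $ 1 *s e {i, j} + A i j $ r $ 2 *s f {i, j}) = 0"
    by (simp add: comb_def)
qed

end

context generic_lagrangian
begin

text \<open>A combination of relations is again a relation, so once it vanishes on one edge it
  vanishes on all: independence spreads from one edge to every other.\<close>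

lemma families_independent:
  assumes "p \<in> relations F i" "q \<in> relations F i" "i \<noteq> k" "i \<noteq> j"
    and indep: "\<And>a b. a *s p k + b *s q k = 0 \<Longrightarrow> a = 0 \<and> b = 0"
    and "a *s p j + b *s q j = 0"
  shows "a = 0 \<and> b = 0"
proof -
  have "(\<lambda>j. a *s p j + b *s q j) \<in> relations F i"
    using assms(1,2) by (intro relations_add relations_scale)
  from relation_unique[OF assms(4) this assms(6)] show ?thesis
    by (rule indep)
qed

lemma edge_bases_exist: "\<exists>e f. edge_bases F e f"
proof -
  have "\<exists>e f. e \<noteq> f \<and> vec.independent {e, f} \<and> vec.span {e, f} = edge_space F b" if "b \<in> edges" for b
  proof -
    obtain i j where b: "b = {i, j}" "i \<noteq> j"
      using \<open>b \<in> edges\<close> by (auto simp: edges_def card_2_iff)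
    obtain B where B: "B \<subseteq> edge_space F b" "vec.independent B" "edge_space F b \<subseteq> vec.span B"
      "card B = vec.dim (edge_space F b)"
      using vec.basis_exists by blast
    then have "card B = 2"
      using b dim_edge_space by simp
    then obtain e f where "B = {e, f}" "e \<noteq> f"
      by (auto simp: card_2_iff)
    moreover have "vec.span B \<subseteq> edge_space F b"
      using B(1) subspace_edge_space by (rule vec.span_minimal)
    ultimately show ?thesis
      using B by blast
  qed
  then show ?thesis
    unfolding edge_bases_def by metis
qed

text \<open>At every vertex the basis of one edge extends to two relations by
  \<open>relation_exists\<close>, and \<open>families_independent\<close> carries their independence
  to the other edges.\<close>

lemma edge_relations_exist:
  assumes bases: "edge_bases F e f"
  shows "\<exists>A. edge_relations e f A"
proof -
  have "\<exists>p q. p \<in> relations F i \<and> q \<in> relations F i \<and>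
    (\<forall>j a b. i \<noteq> j \<longrightarrow> a *s p j + b *s q j = 0 \<longrightarrow> a = 0 \<and> b = 0)" for i
  proof -
    obtain k where "i \<noteq> k"
      by (metis zero_neq_one)
    note base = edge_basesD[OF bases this]
    obtain p where p: "p \<in> relations F i" "p k = e {i, k}"
      using \<open>i \<noteq> k\<close> base(4) by (rule relation_exists)
    obtain q where q: "q \<in> relations F i" "q k = f {i, k}"
      using \<open>i \<noteq> k\<close> base(5) by (rule relation_exists)
    have "a = 0 \<and> b = 0" if "i \<noteq> j" "a *s p j + b *s q j = 0" for j a b
      using p q that independent_pair_zero[OF base(2,1)]
      by (intro families_independent[OF p(1) q(1) \<open>i \<noteq> k\<close> that(1) _ that(2)]) auto
    then show ?thesis
      using p q by blast
  qed
  then obtain p q where pq: "\<And>i. p i \<in> relations F i" "\<And>i. q i \<in> relations F i"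
    "\<And>i j a b. i \<noteq> j \<Longrightarrow> a *s p i j + b *s q i j = 0 \<Longrightarrow> a = 0 \<and> b = 0"
    by metis
  have "\<exists>c. d = comb (e {i, j}) (f {i, j}) c" if "i \<noteq> j" "d \<in> edge_space F {i, j}" for i j d
    using that edge_basesD(3)[OF bases that(1)] by (auto simp: span_pair_eq_comb)
  then obtain C where C: "\<And>i j d. i \<noteq> j \<Longrightarrow> d \<in> edge_space F {i, j} \<Longrightarrow>
      d = comb (e {i, j}) (f {i, j}) (C i j d)"
    by metis
  define A :: "vertex \<Rightarrow> vertex \<Rightarrow> complex^2^2"
    where "A i j = (\<chi> r. if r = 1 then C i j (p i j) else C i j (q i j))" for i j
  have "edge_relations e f A"
    using pq C by (intro edge_relations_of_families[OF bases pq]) (auto simp: A_def relations_edge)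
  then show ?thesis
    by blast
qed

text \<open>Excluding 1 gives isotropy; excluding -1 as well makes an eigenvalue differ from its
  inverse, which later yields two independent eigenvectors.\<close>

lemma holonomy_eigenvector_isotropic:
  assumes "p \<in> relations F 0" "q \<in> relations F 1" "r \<in> relations F 2"
    and "q 2 = r 1" "r 0 = p 2" "p 1 = \<mu> *s q 0" "q 0 \<noteq> 0"
  shows "\<mu> \<noteq> 1" "\<mu> \<noteq> -1" "isotropic 0 p"
proof -
  show \<mu>: "\<mu> \<noteq> 1" "\<mu> \<noteq> -1"
    using no_unit_holonomy[OF assms(1-6)] assms(7) by auto
  have d: "distinct [0, 1, 2, 3 :: vertex]"
    by simp
  have "pcomm 3 (p 1) (p 2) = 0"
    by (rule holonomy_isotropic[OF d assms(1-6) \<mu>(1)])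
  then show "isotropic 0 p"
    using assms(1) by (intro isotropicI[OF d])
qed

text \<open>The relation \<open>p\<close> is carried across the edges \<open>0i\<close> to all
  vertices. By \<open>isotropic_eigenvector\<close> the relations obtained at \<open>i\<close> and
  \<open>j\<close> are proportional on \<open>ij\<close>, so one operator per edge describes them
  all.\<close>

lemma isotropic_family:
  assumes p: "p \<in> relations F 0" "isotropic 0 p" "p 1 \<noteq> 0"
  obtains P C \<epsilon> where "P 0 = p" "\<And>i. P i \<in> relations F i" "\<And>i. i \<noteq> 0 \<Longrightarrow> P i 0 = p i"
    "\<And>i j. i \<noteq> j \<Longrightarrow> P i j = C i j *s \<epsilon> {i, j}" "\<And>i j. i \<noteq> j \<Longrightarrow> C i j \<noteq> 0"
    "\<And>i j. i \<noteq> j \<Longrightarrow> \<epsilon> {i, j} \<in> {P i j, P j i}"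
proof -
  have p_nonzero: "p i \<noteq> 0" if "i \<noteq> 0" for i
    using relation_unique[of 0 i p 1] p that by auto
  have "\<exists>r. r \<in> relations F i \<and> (i = 0 \<longrightarrow> r = p) \<and> (i \<noteq> 0 \<longrightarrow> r 0 = p i)" for i
  proof (cases "i = 0")
    case False
    then have "p i \<in> edge_space F {i, 0}"
      using relations_edge[OF p(1), of i] by (simp add: insert_commute)
    with False show ?thesis
      by (metis relation_exists)
  qed (use p in auto)
  then obtain P where P: "\<And>i. P i \<in> relations F i" "P 0 = p" "\<And>i. i \<noteq> 0 \<Longrightarrow> P i 0 = p i"
    by metis
  \<comment> \<open>An unordered edge has no preferred end, so either \<open>P i j\<close> or
    \<open>P j i\<close> is chosen; the factors \<open>C\<close> absorb the choice.\<close>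
  define \<epsilon> where "\<epsilon> b = (SOME d. \<exists>i j. i \<noteq> j \<and> b = {i, j} \<and> d = P i j)" for b
  have \<epsilon>: "\<epsilon> {i, j} \<in> {P i j, P j i}" if "i \<noteq> j" for i j
  proof -
    have "\<exists>i' j'. i' \<noteq> j' \<and> {i, j} = {i', j'} \<and> \<epsilon> {i, j} = P i' j'"
      unfolding \<epsilon>_def by (rule someI_ex) (use that in blast)
    then show ?thesis
      by (auto simp: doubleton_eq_iff)
  qed
  have proportional: "\<exists>c. c \<noteq> 0 \<and> P i j = c *s P j i" if "i \<noteq> j" for i j
  proof (cases "i = 0 \<or> j = 0")
    case True
    then have "P i j = 1 *s P j i"
      using that P by auto
    then show ?thesis
      by (metis zero_neq_one)
  next
    case False
    then have "distinct [0, i, j]"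
      using that by auto
    moreover have "p i \<noteq> 0" "P i 0 = p i" "P j 0 = p j"
      using False P p_nonzero by auto
    ultimately show ?thesis
      using isotropic_eigenvector[OF _ p(1,2) _ P(1) _ P(1)] by metis
  qed
  have "\<exists>c. c \<noteq> 0 \<and> P i j = c *s \<epsilon> {i, j}" if "i \<noteq> j" for i j
  proof (cases "\<epsilon> {i, j} = P i j")
    case True
    then show ?thesis
      by (metis vec.scale_one zero_neq_one)
  next
    case False
    then show ?thesis
      using \<epsilon>[OF that] proportional[OF that] by auto
  qed
  then obtain C where "\<And>i j. i \<noteq> j \<Longrightarrow> C i j \<noteq> 0 \<and> P i j = C i j *s \<epsilon> {i, j}"
    by metis
  with P \<epsilon> show thesis
    by (intro that[of P C \<epsilon>]) auto
qed

text \<open>Starting from arbitrary bases, the eigenvalues \<open>\<mu>\<close> and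
  \<open>inverse \<mu>\<close> of the holonomy of \<open>012\<close> give two isotropic relations at
  0. The family of the first supplies all \<open>e\<close>, that of the second all \<open>f\<close>,
  and the factors \<open>C\<close>, \<open>C'\<close> are the diagonal entries.\<close>

lemma diagonal_bases_exist: "\<exists>e f A. edge_bases F e f \<and> edge_relations e f A \<and> all_diagonal A"
proof -
  obtain e0 f0 A0 where bases0: "edge_bases F e0 f0" "edge_relations e0 f0 A0"
    using edge_bases_exist edge_relations_exist by blast
  have d: "distinct [0, 1, 2 :: vertex]" and ne: "(0 :: vertex) \<noteq> 1"
    by simp_all
  let ?M = "triangle_matrix A0 0 1 2" and ?comb = "comb (e0 {0, 1}) (f0 {0, 1})"
  obtain \<mu> where \<mu>: "\<mu> \<noteq> 0" "{x. \<exists>c. c \<noteq> 0 \<and> c v* ?M = x *s c} = {\<mu>, inverse \<mu>}"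
    using det_triangle_matrix[OF bases0 d] by (rule left_eigenvalues)
  then obtain c c' where c: "c \<noteq> 0" "c v* ?M = \<mu> *s c" and c': "c' \<noteq> 0" "c' v* ?M = inverse \<mu> *s c'"
    by blast
  have comb0: "?comb x = 0 \<longleftrightarrow> x = 0" for x
    using edge_basesD[OF bases0(1) ne] by (intro comb_eq_0_iff)
  obtain p q r where p: "p \<in> relations F 0" "q \<in> relations F 1" "r \<in> relations F 2"
    "q 0 = ?comb c" "q 2 = r 1" "r 0 = p 2" "p 1 = \<mu> *s q 0"
    using row_relation_eigen[OF bases0 d c(2)] by metis
  have isotropic: "isotropic 0 p" and "\<mu> \<noteq> 1" "\<mu> \<noteq> -1"
    using holonomy_eigenvector_isotropic[OF p(1-3,5-7)] p(4) c(1) comb0 by auto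
  obtain p' q' r' where p': "p' \<in> relations F 0" "q' \<in> relations F 1" "r' \<in> relations F 2"
    "q' 0 = ?comb c'" "q' 2 = r' 1" "r' 0 = p' 2" "p' 1 = inverse \<mu> *s q' 0"
    using row_relation_eigen[OF bases0 d c'(2)] by metis
  have isotropic': "isotropic 0 p'"
    using holonomy_eigenvector_isotropic(3)[OF p'(1-3,5-7)] p'(4) c'(1) comb0 by auto
  have "\<mu> * \<mu> \<noteq> 1"
    using \<open>\<mu> \<noteq> 1\<close> \<open>\<mu> \<noteq> -1\<close> square_eq_1_iff by blast
  then have "\<mu> \<noteq> inverse \<mu>"
    using \<mu>(1) by (metis right_inverse)
  have independent: "a = 0 \<and> b = 0" if "a *s p 1 + b *s p' 1 = 0" for a b
  proof -
    have "?comb ((a * \<mu>) *s c + (b * inverse \<mu>) *s c') = 0"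
      using that by (simp add: p p' comb_add comb_scale)
    then have *: "(a * \<mu>) *s c + (b * inverse \<mu>) *s c' = 0"
      by (simp only: comb0)
    have "((a * \<mu>) *s c + (b * inverse \<mu>) *s c') v* ?M =
        (a * \<mu>) *s (c v* ?M) + (b * inverse \<mu>) *s (c' v* ?M)"
      by (simp add: vec_eq_iff vector_matrix_mult_2 forall_2 algebra_simps)
    then have **: "(a * \<mu> * \<mu>) *s c + (b * inverse \<mu> * inverse \<mu>) *s c' = 0"
      unfolding * c(2) c'(2) by simp
    \<comment> \<open>Elimination between a vanishing combination and its image under the holonomy
      isolates each eigenvector, with the difference of the eigenvalues as a factor.\<close>
    have combine: "s * m * (m - n) * x = 0" "t * n * (n - m) * y = 0"
      if "s * m * x + t * n * y = 0" "s * m * m * x + t * n * n * y = 0" for s t m n x y :: complex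
      using that by algebra+
    have "(a * \<mu> * (\<mu> - inverse \<mu>)) *s c = 0" "(b * inverse \<mu> * (inverse \<mu> - \<mu>)) *s c' = 0"
      using * ** combine(1)[of a \<mu> _ b "inverse \<mu>"] combine(2)[of a \<mu> _ b "inverse \<mu>"]
      unfolding vec_eq_iff forall_2 by auto
    then show ?thesis
      using c c' \<mu>(1) \<open>\<mu> \<noteq> inverse \<mu>\<close> by auto
  qed
  then have "p 1 \<noteq> 0" "p' 1 \<noteq> 0"
    using independent[of 1 0] independent[of 0 1] by auto
  obtain P C e where P: "P 0 = p" "\<And>i. P i \<in> relations F i" "\<And>i. i \<noteq> 0 \<Longrightarrow> P i 0 = p i"
    "\<And>i j. i \<noteq> j \<Longrightarrow> P i j = C i j *s e {i, j}" "\<And>i j. i \<noteq> j \<Longrightarrow> C i j \<noteq> 0"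
    "\<And>i j. i \<noteq> j \<Longrightarrow> e {i, j} \<in> {P i j, P j i}"
    using isotropic_family[OF p(1) isotropic \<open>p 1 \<noteq> 0\<close>] by metis
  obtain P' C' f where P': "P' 0 = p'" "\<And>i. P' i \<in> relations F i" "\<And>i. i \<noteq> 0 \<Longrightarrow> P' i 0 = p' i"
    "\<And>i j. i \<noteq> j \<Longrightarrow> P' i j = C' i j *s f {i, j}" "\<And>i j. i \<noteq> j \<Longrightarrow> C' i j \<noteq> 0"
    "\<And>i j. i \<noteq> j \<Longrightarrow> f {i, j} \<in> {P' i j, P' j i}"
    using isotropic_family[OF p'(1) isotropic' \<open>p' 1 \<noteq> 0\<close>] by metis
  have independent_0: "a = 0 \<and> b = 0" if "j \<noteq> 0" "a *s p j + b *s p' j = 0" for a b j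
    by (rule families_independent[OF p(1) p'(1) ne that(1)[symmetric] independent that(2)])
  have families: "a = 0 \<and> b = 0" if "i \<noteq> j" "a *s P i j + b *s P' i j = 0" for a b i j
  proof (cases "i = 0")
    case True
    then show ?thesis
      using that independent_0[of j] P(1) P'(1) by auto
  next
    case False
    show ?thesis
      by (rule families_independent[OF P(2) P'(2) False that(1) _ that(2)])
         (use False independent_0 P(3) P'(3) in auto)
  qed
  have "P i j \<in> edge_space F {i, j}" "P j i \<in> edge_space F {i, j}"
    "P' i j \<in> edge_space F {i, j}" "P' j i \<in> edge_space F {i, j}" if "i \<noteq> j" for i j
    using relations_edge[OF P(2)] relations_edge[OF P'(2)] that insert_commute[of i j "{}"] by metis+
  then have in_edge: "e {i, j} \<in> edge_space F {i, j}" "f {i, j} \<in> edge_space F {i, j}"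
    if "i \<noteq> j" for i j
    using P(6)[OF that] P'(6)[OF that] that by auto
  have "e b \<noteq> f b \<and> vec.independent {e b, f b} \<and> vec.span {e b, f b} = edge_space F b" if "b \<in> edges" for b
  proof -
    obtain i j where b: "b = {i, j}" "i \<noteq> j"
      using \<open>b \<in> edges\<close> by (auto simp: edges_def card_2_iff)
    have ef: "x = 0 \<and> y = 0" if "x *s e b + y *s f b = 0" for x y
    proof -
      have "(x / C i j) *s P i j + (y / C' i j) *s P' i j = 0"
        using that b P(4,5) P'(4,5) by simp
      from families[OF b(2) this] show ?thesis
        using b P(5) P'(5) by simp
    qed
    have "e b \<noteq> 0"
      using ef[of 1 0] by auto
    moreover have "\<nexists>x. f b = x *s e b"
    proof
      assume "\<exists>x. f b = x *s e b"
      then obtain x where "(- x) *s e b + 1 *s f b = 0"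
        by auto
      from ef[OF this] show False
        by simp
    qed
    ultimately show ?thesis
      using edge_space_span_pair[OF b(2)] in_edge[OF b(2)] by (simp add: b(1))
  qed
  then have bases: "edge_bases F e f"
    by (simp add: edge_bases_def)
  define A :: "vertex \<Rightarrow> vertex \<Rightarrow> complex^2^2"
    where "A i j = (\<chi> r s. if r = s then if r = 1 then C i j else C' i j else 0)" for i j
  have "edge_relations e f A"
  proof (rule edge_relations_of_families[OF bases P(2) P'(2)])
    fix i j :: vertex assume "i \<noteq> j"
    then show "a = 0 \<and> b = 0" if "a *s P i j + b *s P' i j = 0" for a b
      using that by (rule families)
    show "P i j = comb (e {i, j}) (f {i, j}) (A i j $ 1)"
      "P' i j = comb (e {i, j}) (f {i, j}) (A i j $ 2)"
      using \<open>i \<noteq> j\<close> by (simp_all add: A_def comb_def P(4) P'(4))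
  qed
  moreover have "all_diagonal A"
    by (simp add: all_diagonal_def A_def)
  ultimately show ?thesis
    using bases by blast
qed

text \<open>A family that is proportional along every edge becomes, after rescaling, an eigenvector
  of the holonomy of \<open>012\<close>. This gives isotropy at 0, which then crosses the edge
  \<open>0i\<close>.\<close>

lemma diagonal_family_isotropic:
  assumes rel: "\<And>i. P i \<in> relations F i"
    and P: "\<And>i j. i \<noteq> j \<Longrightarrow> P i j = a i j *s g {i, j}" "\<And>i j. i \<noteq> j \<Longrightarrow> a i j \<noteq> 0"
      "\<And>i j. i \<noteq> j \<Longrightarrow> g {i, j} \<noteq> 0"
  shows "isotropic i (P i)"
proof -
  \<comment> \<open>The scale \<open>x\<close> turns \<open>P 1 0\<close> into the operator of the
    edge \<open>01\<close>; \<open>y\<close> and \<open>z\<close> are forced by agreement on the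
    edges \<open>12\<close> and \<open>02\<close>.\<close>
  define x y z where "x = inverse (a 1 0)" and "y = x * a 1 2 / a 2 1" and "z = y * a 2 0 / a 0 2"
  have nz: "a 1 0 \<noteq> 0" "a 2 1 \<noteq> 0" "a 0 2 \<noteq> 0" "a 2 0 \<noteq> 0" "a 1 2 \<noteq> 0"
    by (rule P(2), simp)+
  have sym: "{2, 1} = {1, 2 :: vertex}" "{1, 0} = {0, 1 :: vertex}" "{2, 0} = {0, 2 :: vertex}"
    by auto
  have "isotropic 0 (\<lambda>j. z *s P 0 j)"
  proof (rule holonomy_eigenvector_isotropic(3))
    show "(\<lambda>j. z *s P 0 j) \<in> relations F 0" "(\<lambda>j. x *s P 1 j) \<in> relations F 1"
      "(\<lambda>j. y *s P 2 j) \<in> relations F 2"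
      using rel by (auto intro: relations_scale)
    show "x *s P 1 2 = y *s P 2 1" "y *s P 2 0 = z *s P 0 2"
      "z *s P 0 1 = (z * a 0 1) *s (x *s P 1 0)" "x *s P 1 0 \<noteq> 0"
      using nz P(3)[of 0 1] by (simp_all add: P(1) x_def y_def z_def sym)
  qed
  from isotropic_scale[OF this, of "inverse z"] have iso0: "isotropic 0 (P 0)"
    using nz by (simp add: x_def y_def z_def)
  show ?thesis
  proof (cases "i = 0")
    case False
    have "isotropic i (\<lambda>j. (a 0 i / a i 0) *s P i j)"
    proof (rule isotropic_across_edge[OF _ rel relations_scale[OF rel] _ iso0])
      show "0 \<noteq> i" "P 0 i = (a 0 i / a i 0) *s P i 0"
        using False P(2)[of i 0] by (auto simp: P(1) insert_commute)
    qed
    from isotropic_scale[OF this, of "a i 0 / a 0 i"] show ?thesis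
      using False P(2)[of i 0] P(2)[of 0 i] by simp
  qed (use iso0 in simp)
qed

text \<open>If \<open>t\<close> contains both edges, they are equal, adjacent or opposite. Isotropy
  handles the adjacent case and \<open>pcomm_opposite\<close> the last one.\<close>

lemma diagonal_family_pcomm:
  assumes rel: "\<And>i. P i \<in> relations F i"
    and P: "\<And>i j. i \<noteq> j \<Longrightarrow> P i j = a i j *s g {i, j}" "\<And>i j. i \<noteq> j \<Longrightarrow> a i j \<noteq> 0"
      "\<And>i j. i \<noteq> j \<Longrightarrow> g {i, j} \<noteq> 0" "\<And>i j. i \<noteq> j \<Longrightarrow> g {i, j} \<in> edge_space F {i, j}"
    and b: "b \<in> edges" "b' \<in> edges"
  shows "pcomm t (g b) (g b') = 0"
proof -
  have adjacent: "pcomm t (g {i, j}) (g {i, k}) = 0" if "distinct [i, j, k, t]" for i j k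
  proof -
    have "pcomm t (P i j) (P i k) = 0"
      using diagonal_family_isotropic[OF rel P(1-3), of i] that by (auto simp: isotropic_def)
    then show ?thesis
      using that P(2)[of i j] P(2)[of i k] by (auto simp: P(1) pcomm_scale_left pcomm_scale_right)
  qed
  obtain i j where ij: "b = {i, j}" "i \<noteq> j"
    using b(1) by (auto simp: edges_def card_2_iff)
  obtain k l where kl: "b' = {k, l}" "k \<noteq> l"
    using b(2) by (auto simp: edges_def card_2_iff)
  show ?thesis
  proof (cases "t \<in> b \<or> t \<in> b'")
    case True
    then have "component t (g b) = 0 \<or> component t (g b') = 0"
      using P(4)[OF ij(2)] P(4)[OF kl(2)] unfolding ij kl by (auto simp: edge_space_iff)
    then show ?thesis
      by (auto simp: pcomm_component_zero)
  next
    case False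
    then have t: "t \<noteq> i" "t \<noteq> j" "t \<noteq> k" "t \<noteq> l"
      by (auto simp: ij kl)
    consider "b = b'" | "i = k" "j \<noteq> l" | "i = l" "j \<noteq> k" | "j = k" "i \<noteq> l" | "j = l" "i \<noteq> k"
      | "distinct [i, j, k, l, t]"
      using ij kl t by auto
    then show ?thesis
    proof cases
      case 1
      then show ?thesis by simp
    next
      case 2
      then show ?thesis
        using adjacent[of i j l] ij kl t by auto
    next
      case 3
      then show ?thesis
        using adjacent[of i j k] ij kl t by (auto simp: insert_commute)
    next
      case 4
      then show ?thesis
        using adjacent[of j i l] ij kl t by (auto simp: insert_commute)
    next
      case 5
      then show ?thesis
        using adjacent[of j i k] ij kl t by (auto simp: insert_commute)
    next
      case 6
      then show ?thesis
        using pcomm_opposite[of i j k l t] P(4) ij kl by simp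
    qed
  qed
qed

text \<open>Diagonality separates the rows: the first rows form a family in the \<open>e\<close>
  alone, the second rows one in the \<open>f\<close> alone.\<close>

lemma diagonal_bases_pcomm:
  assumes bases: "edge_bases F e f" and rel: "edge_relations e f A" and diag: "all_diagonal A"
    and b: "b \<in> edges" "b' \<in> edges"
  shows "pcomm t (e b) (e b') = 0" "pcomm t (f b) (f b') = 0"
proof -
  have off: "A i j $ 1 $ 2 = 0" "A i j $ 2 $ 1 = 0" if "i \<noteq> j" for i j
    using diag that by (auto simp: all_diagonal_def)
  have on: "A i j $ 1 $ 1 \<noteq> 0" "A i j $ 2 $ 2 \<noteq> 0" if "i \<noteq> j" for i j
  proof -
    have "det (A i j) \<noteq> 0"
      using rel that by (simp add: edge_relations_def flip: invertible_det_nz)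
    then show "A i j $ 1 $ 1 \<noteq> 0" "A i j $ 2 $ 2 \<noteq> 0"
      by (auto simp: det_2 off[OF that])
  qed
  have row: "row_relation e f A i (axis 1 1) j = A i j $ 1 $ 1 *s e {i, j}"
    "row_relation e f A i (axis 2 1) j = A i j $ 2 $ 2 *s f {i, j}" if "i \<noteq> j" for i j
    using that by (auto simp: row_relation_def comb_def vector_matrix_mult_2 axis_def off)
  have nz: "e {i, j} \<noteq> 0" "f {i, j} \<noteq> 0" if "i \<noteq> j" for i j
    using edge_basesD(2)[OF bases that] vec.dependent_zero by (metis insertI1 insertI2)+
  show "pcomm t (e b) (e b') = 0"
    using row_relation[OF bases rel] row(1) on(1) nz(1) edge_basesD(4)[OF bases] b
    by (rule diagonal_family_pcomm)
  show "pcomm t (f b) (f b') = 0"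
    using row_relation[OF bases rel] row(2) on(2) nz(2) edge_basesD(5)[OF bases] b
    by (rule diagonal_family_pcomm)
qed

lemma triangle_eigenvalues:
  assumes "edge_bases F e f" "edge_relations e f A" "distinct [i, j, k]"
  shows "\<exists>\<phi>. maps_basis (e {i, j}) (f {i, j}) (triangle_matrix A i j k) \<phi> \<and>
    bij_betw \<phi> (edge_space F {i, j}) (edge_space F {i, j}) \<and>
    (\<exists>\<mu>. \<mu> \<noteq> 0 \<and> eigenvalues_on (edge_space F {i, j}) \<phi> = {\<mu>, inverse \<mu>})"
proof -
  have "i \<noteq> j"
    using assms(3) by simp
  note base = edge_basesD[OF assms(1) this]
  show ?thesis
    using maps_basis_exists[OF base(2,1) det_triangle_matrix[OF assms]] unfolding base(3) .
qed

end

section \<open>Zariski-open conditions\<close>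

lemma polyfun_sum:
  "(\<And>i. i \<in> I \<Longrightarrow> h i \<in> polyfun C) \<Longrightarrow> (\<lambda>z. \<Sum>i\<in>I. h i z) \<in> polyfun C"
  by (induction I rule: infinite_finite_induct) (auto intro: polyfun.const polyfun.add)

lemma polyfun_prod:
  "(\<And>i. i \<in> I \<Longrightarrow> h i \<in> polyfun C) \<Longrightarrow> (\<lambda>z. \<Prod>i\<in>I. h i z) \<in> polyfun C"
  by (induction I rule: infinite_finite_induct) (auto intro: polyfun.const polyfun.mult)

lemma polyfun_det:
  assumes "\<And>i j. (\<lambda>z. M z $ i $ j) \<in> polyfun C"
  shows "(\<lambda>z. det (M z)) \<in> polyfun C"
  unfolding det_def by (intro polyfun_sum polyfun_prod polyfun.mult polyfun.const assms)

text \<open>Openness for predicates on all matrices; the restriction to symmetric ones is made in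
  \<open>zariski_open_of_cond\<close>.\<close>

definition zariski_cond :: "(complex^variable^variable \<Rightarrow> bool) \<Rightarrow> bool" where
  "zariski_cond Q \<longleftrightarrow> (\<exists>S \<subseteq> polyfun (range (\<lambda>(p, q) F. F $ p $ q)). \<forall>F. Q F \<longleftrightarrow> (\<exists>P\<in>S. P F \<noteq> 0))"

text \<open>Pairwise products of the two sets of polynomials work, because a product of complex
  numbers is nonzero exactly when both factors are.\<close>

lemma zariski_cond_conj:
  assumes "zariski_cond Q" "zariski_cond R"
  shows "zariski_cond (\<lambda>F. Q F \<and> R F)"
proof -
  obtain S where S: "S \<subseteq> polyfun (range (\<lambda>(p, q) F. F $ p $ q))" "\<And>F. Q F \<longleftrightarrow> (\<exists>P\<in>S. P F \<noteq> 0)"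
    using assms(1) unfolding zariski_cond_def by blast
  obtain T where T: "T \<subseteq> polyfun (range (\<lambda>(p, q) F. F $ p $ q))" "\<And>F. R F \<longleftrightarrow> (\<exists>P\<in>T. P F \<noteq> 0)"
    using assms(2) unfolding zariski_cond_def by blast
  let ?ST = "(\<lambda>(P, P') F. P F * P' F) ` (S \<times> T)"
  have "?ST \<subseteq> polyfun (range (\<lambda>(p, q) F. F $ p $ q))"
    using S(1) T(1) by (auto intro!: polyfun.mult)
  moreover have "Q F \<and> R F \<longleftrightarrow> (\<exists>P\<in>?ST. P F \<noteq> 0)" for F
  proof -
    have "(\<exists>P\<in>?ST. P F \<noteq> 0) \<longleftrightarrow> (\<exists>x\<in>S \<times> T. fst x F * snd x F \<noteq> 0)"
      unfolding Set.bex_simps split_beta ..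
    also have "\<dots> \<longleftrightarrow> (\<exists>P\<in>S. P F \<noteq> 0) \<and> (\<exists>P\<in>T. P F \<noteq> 0)"
      by auto
    finally show ?thesis
      unfolding S(2) T(2) by (rule sym)
  qed
  ultimately show ?thesis
    unfolding zariski_cond_def by blast
qed

lemma zariski_cond_ball:
  assumes "finite I" "\<And>i. i \<in> I \<Longrightarrow> zariski_cond (Q i)"
  shows "zariski_cond (\<lambda>F. \<forall>i\<in>I. Q i F)"
  using assms
proof (induction I rule: finite_induct)
  case empty
  have "{\<lambda>_. 1} \<subseteq> polyfun (range (\<lambda>(p, q) F. F $ p $ q))"
    by (auto intro: polyfun.const)
  then show ?case
    unfolding zariski_cond_def by (intro exI[of _ "{\<lambda>_. 1}"]) auto
next
  case (insert i I)
  then show ?case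
    using zariski_cond_conj[of "Q i" "\<lambda>F. \<forall>i\<in>I. Q i F"] by simp
qed

lemma zariski_open_of_cond: "zariski_cond Q \<Longrightarrow> zariski_open {F \<in> sym_matrices. Q F}"
  unfolding zariski_cond_def zariski_open_def by auto

section \<open>Homogeneous linear conditions and their kernels\<close>

text \<open>The equations have constant coefficients. The matrix \<open>F\<close> enters later, only
  through the requirement that the operators lie in \<open>lag F\<close>.\<close>

definition linear_cond :: "(('k::finite \<Rightarrow> opr) \<Rightarrow> bool) \<Rightarrow> bool" where
  "linear_cond E \<longleftrightarrow> (\<exists>Q. \<forall>r. E r \<longleftrightarrow> (\<forall>(c, g)\<in>Q. (\<Sum>k\<in>UNIV. c k * r k $ g) = 0))"

lemma linear_cond_ball:
  assumes "\<And>x. x \<in> I \<Longrightarrow> linear_cond (E x)"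
  shows "linear_cond (\<lambda>r. \<forall>x\<in>I. E x r)"
proof -
  have "\<forall>x\<in>I. \<exists>Q. \<forall>r. E x r \<longleftrightarrow> (\<forall>(c, g)\<in>Q. (\<Sum>k\<in>UNIV. c k * r k $ g) = 0)"
    using assms unfolding linear_cond_def by blast
  from bchoice[OF this] obtain Q where
    "\<forall>x\<in>I. \<forall>r. E x r \<longleftrightarrow> (\<forall>(c, g)\<in>Q x. (\<Sum>k\<in>UNIV. c k * r k $ g) = 0)" ..
  then show ?thesis
    unfolding linear_cond_def by (intro exI[of _ "\<Union>x\<in>I. Q x"]) auto
qed

lemma linear_cond_conj:
  assumes "linear_cond E" "linear_cond E'"
  shows "linear_cond (\<lambda>r. E r \<and> E' r)"
proof -
  obtain Q where "\<And>r. E r \<longleftrightarrow> (\<forall>(c, g)\<in>Q. (\<Sum>k\<in>UNIV. c k * r k $ g) = 0)"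
    using assms(1) unfolding linear_cond_def by blast
  moreover obtain Q' where "\<And>r. E' r \<longleftrightarrow> (\<forall>(c, g)\<in>Q'. (\<Sum>k\<in>UNIV. c k * r k $ g) = 0)"
    using assms(2) unfolding linear_cond_def by blast
  ultimately show ?thesis
    unfolding linear_cond_def by (intro exI[of _ "Q \<union> Q'"]) (simp add: ball_Un)
qed

lemma linear_cond_coord: "linear_cond (\<lambda>r. (\<Sum>k\<in>UNIV. c k * r k $ g) = 0)"
  unfolding linear_cond_def by (intro exI[of _ "{(c, g)}"]) auto

lemma linear_cond_sum: "linear_cond (\<lambda>r. (\<Sum>k\<in>UNIV. c k *s r k) = 0)"
proof -
  have "linear_cond (\<lambda>r. \<forall>g\<in>UNIV. (\<Sum>k\<in>UNIV. c k * r k $ g) = 0)"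
    by (intro linear_cond_ball linear_cond_coord)
  then show ?thesis
    by (simp add: vec_eq_iff sum_component)
qed

lemma linear_cond_component: "linear_cond (\<lambda>r. component t (r j) = 0)"
proof -
  have "(\<Sum>k\<in>UNIV. (if k = j then 1 else 0) * r k $ g) = r j $ g" for r :: "'a \<Rightarrow> opr" and g
    by (simp add: if_distrib[of "\<lambda>x. x * _"] cong: if_cong)
  moreover have "linear_cond (\<lambda>r. \<forall>g\<in>{g. gen_tet g = t}.
      (\<Sum>k\<in>UNIV. (if k = j then 1 else 0) * r k $ g) = 0)"
    by (intro linear_cond_ball linear_cond_coord)
  ultimately show ?thesis
    by (simp add: component_eq_0_iff)
qed

lemma linear_cond_eq:
  assumes "i \<noteq> j"
  shows "linear_cond (\<lambda>r. r i = a *s r j)"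
proof -
  have "(\<Sum>k\<in>UNIV. (if k = i then 1 else if k = j then - a else 0) *s r k) = r i - a *s r j"
    for r :: "'a \<Rightarrow> opr"
  proof -
    have "(\<Sum>k\<in>UNIV. (if k = i then 1 else if k = j then - a else 0) *s r k) =
        (\<Sum>k\<in>UNIV. (if k = i then r k else 0) + (if k = j then (- a) *s r k else 0))"
      using assms by (intro sum.cong) auto
    then show ?thesis
      by (simp add: sum.distrib)
  qed
  then show ?thesis
    using linear_cond_sum[of "\<lambda>k. if k = i then 1 else if k = j then - a else 0"] by simp
qed

lemma linear_cond_zero: "linear_cond (\<lambda>r. r i = 0)"
proof -
  have "(\<Sum>k\<in>UNIV. (if k = i then 1 else 0) *s r k) = r i" for r :: "'a \<Rightarrow> opr"
    by (simp add: if_distrib[of "\<lambda>x. x *s _"] cong: if_cong)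
  then show ?thesis
    using linear_cond_sum[of "\<lambda>k. if k = i then 1 else 0"] by simp
qed

text \<open>Allows several families to be packed into one; coefficients are extended by zero outside
  the range of \<open>h\<close>.\<close>

lemma linear_cond_reindex:
  fixes h :: "'k::finite \<Rightarrow> 'l::finite"
  assumes "linear_cond E" "inj h"
  shows "linear_cond (\<lambda>r. E (\<lambda>k. r (h k)))"
proof -
  obtain Q where Q: "\<And>r. E r \<longleftrightarrow> (\<forall>(c, g)\<in>Q. (\<Sum>k\<in>UNIV. c k * r k $ g) = 0)"
    using assms(1) unfolding linear_cond_def by blast
  have "(\<Sum>l\<in>UNIV. (if l \<in> range h then c (inv h l) else 0) * r l $ g) =
      (\<Sum>k\<in>UNIV. c k * r (h k) $ g)" for c g and r :: "'l \<Rightarrow> opr"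
  proof -
    have "(\<Sum>l\<in>UNIV. (if l \<in> range h then c (inv h l) else 0) * r l $ g) =
        (\<Sum>l\<in>range h. c (inv h l) * r l $ g)"
      by (intro sum.mono_neutral_cong_right) auto
    also have "\<dots> = (\<Sum>k\<in>UNIV. c k * r (h k) $ g)"
      using assms(2) by (simp add: sum.reindex)
    finally show ?thesis .
  qed
  then show ?thesis
    unfolding linear_cond_def Q
    by (intro exI[of _ "(\<lambda>(c, g). (\<lambda>l. if l \<in> range h then c (inv h l) else 0, g)) ` Q"]) auto
qed

lemma lag_gen_nth:
  "lag_gen F p $ D q = (if p = q then 1 else 0)" "lag_gen F p $ Z q = F $ p $ q"
  by (auto simp: lag_gen_def axis_def sum_component if_distrib[of "(*) _"] cong: if_cong)

text \<open>Triviality of the kernel becomes nonvanishing of some maximal minor. For the harder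
  direction, a maximal independent set of rows is placed into a square matrix and padded with zero
  rows.\<close>

lemma trivial_kernel_iff:
  fixes R :: "('a::field^'n) set"
  shows "(\<forall>v. (\<forall>w\<in>R. (\<Sum>m\<in>UNIV. w $ m * v $ m) = 0) \<longrightarrow> v = 0) \<longleftrightarrow>
    (\<exists>N :: 'a^'n^'n. (\<forall>i. N $ i \<in> R) \<and> det N \<noteq> 0)"
proof
  assume "\<exists>N :: 'a^'n^'n. (\<forall>i. N $ i \<in> R) \<and> det N \<noteq> 0"
  then obtain N :: "'a^'n^'n" where N: "\<And>i. N $ i \<in> R" "det N \<noteq> 0"
    by blast
  show "\<forall>v. (\<forall>w\<in>R. (\<Sum>m\<in>UNIV. w $ m * v $ m) = 0) \<longrightarrow> v = 0"
  proof (intro allI impI)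
    fix v assume "\<forall>w\<in>R. (\<Sum>m\<in>UNIV. w $ m * v $ m) = 0"
    then have "N *v v = 0"
      using N(1) by (simp add: matrix_vector_mult_def vec_eq_iff)
    then show "v = 0"
      using N(2) by (metis invertible_det_nz invertible_left_inverse matrix_left_invertible_ker)
  qed
next
  assume kernel: "\<forall>v. (\<forall>w\<in>R. (\<Sum>m\<in>UNIV. w $ m * v $ m) = 0) \<longrightarrow> v = 0"
  obtain B where B: "B \<subseteq> R" "vec.independent B" "R \<subseteq> vec.span B"
    using vec.maximal_independent_subset by blast
  have "finite B" "card B \<le> CARD('n)"
    using vec.finiteI_independent[OF B(2)] vec.dim_eq_card_independent[OF B(2)]
      vec.dim_subset[OF subset_UNIV[of B]] by (simp_all add: card_cart_basis)
  then obtain h :: "'a^'n \<Rightarrow> 'n" where h: "inj_on h B"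
    using inj_on_iff_card_le[of B "UNIV :: 'n set"] by auto
  define N :: "'a^'n^'n" where "N = (\<chi> i. if i \<in> h ` B then inv_into B h i else 0)"
  have "det N \<noteq> 0"
  proof
    assume "det N = 0"
    then obtain v where v: "v \<noteq> 0" "N *v v = 0"
      by (rule det_eq_0_kernel)
    let ?K = "{w. (\<Sum>m\<in>UNIV. w $ m * v $ m) = 0}"
    have "B \<subseteq> ?K"
    proof
      fix w assume "w \<in> B"
      then have "N $ h w = w"
        using h by (simp add: N_def)
      then show "w \<in> ?K"
        using arg_cong[OF v(2), of "\<lambda>x. x $ h w"] by (simp add: matrix_vector_mult_def)
    qed
    moreover have "vec.subspace ?K"
      by (auto simp: vec.subspace_def sum.distrib algebra_simps simp flip: sum_distrib_left)
    ultimately have "R \<subseteq> ?K"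
      using B(3) vec.span_minimal by blast
    then show False
      using kernel v(1) by blast
  qed
  \<comment> \<open>A padding row would annihilate the determinant, so every row comes from
    \<open>R\<close>.\<close>
  moreover have "N $ i \<in> R" for i
  proof (cases "i \<in> h ` B")
    case True
    then show ?thesis
      using B(1) inv_into_into[OF True] by (auto simp: N_def)
  next
    case False
    then have "row i N = 0"
      by (simp add: row_def N_def vec_eq_iff)
    then have "det N = 0"
      by (rule det_zero_row)
    then show ?thesis
      using \<open>det N \<noteq> 0\<close> by contradiction
  qed
  ultimately show "\<exists>N :: 'a^'n^'n. (\<forall>i. N $ i \<in> R) \<and> det N \<noteq> 0"
    by blast
qed

text \<open>In the coordinates of \<open>lag_opr\<close> the conditions form a linear system whose
  coefficients are polynomial in \<open>F\<close>, so by \<open>trivial_kernel_iff\<close> a trivial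
  kernel means that some maximal minor is nonzero.\<close>

lemma zariski_cond_kernel:
  fixes E :: "('k::finite \<Rightarrow> opr) \<Rightarrow> bool"
  assumes "linear_cond E"
  shows "zariski_cond (\<lambda>F. \<forall>r. (\<forall>k. r k \<in> lag F) \<and> E r \<longrightarrow> (\<forall>k. r k = 0))"
proof -
  obtain Q where Q: "\<And>r. E r \<longleftrightarrow> (\<forall>(c, g)\<in>Q. (\<Sum>k\<in>UNIV. c k * r k $ g) = 0)"
    using assms unfolding linear_cond_def by blast
  define row_of :: "('k \<Rightarrow> complex) \<times> gen \<Rightarrow> complex^variable^variable \<Rightarrow> complex^('k \<times> variable)"
    where "row_of = (\<lambda>(c, g) F. \<chi> m. c (fst m) * lag_gen F (snd m) $ g)"
  define family where "family F v k = lag_opr F (\<chi> p. v $ (k, p))"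
    for F and v :: "complex^('k \<times> variable)" and k
  have row_of: "(\<Sum>m\<in>UNIV. row_of (c, g) F $ m * v $ m) = (\<Sum>k\<in>UNIV. c k * family F v k $ g)"
    for c g F v
  proof -
    have "(\<Sum>m\<in>UNIV. row_of (c, g) F $ m * v $ m) =
        (\<Sum>k\<in>UNIV. \<Sum>p\<in>UNIV. c k * lag_gen F p $ g * v $ (k, p))"
      by (simp add: row_of_def UNIV_Times_UNIV[symmetric] sum.cartesian_product split_beta
          del: UNIV_Times_UNIV)
    also have "\<dots> = (\<Sum>k\<in>UNIV. c k * family F v k $ g)"
      by (simp add: family_def lag_opr_eq_sum sum_component sum_distrib_left mult_ac)
    finally show ?thesis .
  qed
  have family_zero: "(\<forall>k. family F v k = 0) \<longleftrightarrow> v = 0" for F v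
  proof -
    have "lag_opr F x = 0 \<longleftrightarrow> x = 0" for x
      by (auto simp: opr_eq_iff vec_eq_iff)
    then show ?thesis
      by (auto simp: family_def vec_eq_iff)
  qed
  have family_surj: "\<exists>v. r = family F v" if "\<forall>k. r k \<in> lag F" for r F
  proof -
    define x where "x k = inv (lag_opr F) (r k)" for k
    have "r k = lag_opr F (x k)" for k
      using \<open>\<forall>k. r k \<in> lag F\<close> by (simp add: x_def f_inv_into_f lag_eq_range)
    then have "r = family F (\<chi> m. x (fst m) $ snd m)"
      by (simp add: family_def fun_eq_iff)
    then show ?thesis ..
  qed
  have kernel: "(\<forall>r. (\<forall>k. r k \<in> lag F) \<and> E r \<longrightarrow> (\<forall>k. r k = 0)) \<longleftrightarrow>
      (\<forall>v. (\<forall>w\<in>(\<lambda>q. row_of q F) ` Q. (\<Sum>m\<in>UNIV. w $ m * v $ m) = 0) \<longrightarrow> v = 0)" for F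
  proof -
    have E: "E (family F v) \<longleftrightarrow> (\<forall>w\<in>(\<lambda>q. row_of q F) ` Q. (\<Sum>m\<in>UNIV. w $ m * v $ m) = 0)" for v
      unfolding Q by (simp add: row_of split_beta flip: row_of)
    have "family F v k \<in> lag F" for v k
      by (simp add: family_def lag_eq_range)
    then show ?thesis
      unfolding E[symmetric] family_zero[of F, symmetric] using family_surj by metis
  qed
  \<comment> \<open>Minors are indexed by choices \<open>\<phi>\<close> of equations, which makes
    this set of polynomials independent of \<open>F\<close>.\<close>
  let ?S = "{\<lambda>F. det (\<chi> i. row_of (\<phi> i) F) |\<phi>. range \<phi> \<subseteq> Q}"
  have "?S \<subseteq> polyfun (range (\<lambda>(p, q) F. F $ p $ q))"
  proof -
    have "(\<lambda>F. lag_gen F p $ g) \<in> polyfun (range (\<lambda>(p, q) F. F $ p $ q))" for p g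
    proof (cases g)
      case (D q)
      then show ?thesis
        by (simp add: lag_gen_nth polyfun.const)
    next
      case (Z q)
      then show ?thesis
        by (auto simp: lag_gen_nth intro!: polyfun.coord image_eqI[of _ _ "(p, q)"])
    qed
    then have "(\<lambda>F. row_of q F $ m) \<in> polyfun (range (\<lambda>(p, q) F. F $ p $ q))" for q m
      by (simp add: row_of_def split_beta polyfun.mult polyfun.const)
    then have "(\<lambda>F. det (\<chi> i. row_of (\<phi> i) F)) \<in> polyfun (range (\<lambda>(p, q) F. F $ p $ q))"
      for \<phi> :: "'k \<times> variable \<Rightarrow> ('k \<Rightarrow> complex) \<times> gen"
      by (intro polyfun_det) (simp only: vec_lambda_beta)
    then show ?thesis
      by blast
  qed
  moreover have "(\<exists>N. (\<forall>i. N $ i \<in> (\<lambda>q. row_of q F) ` Q) \<and> det N \<noteq> 0) \<longleftrightarrow> (\<exists>P\<in>?S. P F \<noteq> 0)" for F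
  proof
    assume "\<exists>N. (\<forall>i. N $ i \<in> (\<lambda>q. row_of q F) ` Q) \<and> det N \<noteq> 0"
    then obtain N where N: "\<And>i. N $ i \<in> (\<lambda>q. row_of q F) ` Q" "det N \<noteq> 0"
      by blast
    then obtain \<phi> where \<phi>: "\<And>i. \<phi> i \<in> Q" "\<And>i. N $ i = row_of (\<phi> i) F"
      unfolding image_iff by metis
    then have "N = (\<chi> i. row_of (\<phi> i) F)"
      by (simp add: vec_eq_iff)
    then show "\<exists>P\<in>?S. P F \<noteq> 0"
      using N(2) \<phi>(1) by (intro bexI[of _ "\<lambda>F. det (\<chi> i. row_of (\<phi> i) F)"]) auto
  next
    assume "\<exists>P\<in>?S. P F \<noteq> 0"
    then obtain \<phi> where "range \<phi> \<subseteq> Q" "det (\<chi> i. row_of (\<phi> i) F) \<noteq> 0"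
      by auto
    then show "\<exists>N. (\<forall>i. N $ i \<in> (\<lambda>q. row_of q F) ` Q) \<and> det N \<noteq> 0"
      by (intro exI[of _ "\<chi> i. row_of (\<phi> i) F"]) auto
  qed
  ultimately show ?thesis
    unfolding zariski_cond_def kernel trivial_kernel_iff by blast
qed

section \<open>The conditions defining generic matrices\<close>

text \<open>The part of \<open>relations\<close> that does not mention \<open>F\<close>, as
  \<open>zariski_cond_kernel\<close> requires.\<close>

definition relation_cond :: "vertex \<Rightarrow> (vertex \<Rightarrow> opr) \<Rightarrow> bool" where
  "relation_cond i r \<longleftrightarrow> r i = 0 \<and>
    (\<forall>j\<in>UNIV - {i}. component i (r j) = 0 \<and> component j (r j) = 0) \<and> (\<Sum>j\<in>UNIV. r j) = 0"

lemma relations_iff: "r \<in> relations F i \<longleftrightarrow> (\<forall>j. r j \<in> lag F) \<and> relation_cond i r"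
  using vec.subspace_0[OF subspace_lag[of F]]
  by (auto simp: relations_def relation_cond_def edge_space_iff) metis

lemma linear_cond_relation_cond: "linear_cond (relation_cond i)"
proof -
  have "linear_cond (\<lambda>r :: vertex \<Rightarrow> opr. (\<Sum>j\<in>UNIV. 1 *s r j) = 0)"
    by (rule linear_cond_sum)
  then show ?thesis
    unfolding relation_cond_def[abs_def]
    by (intro linear_cond_conj linear_cond_zero linear_cond_ball linear_cond_component) simp_all
qed

definition unique_relations :: "complex^variable^variable \<Rightarrow> vertex \<times> vertex \<Rightarrow> bool" where
  "unique_relations F = (\<lambda>(i, m). \<forall>r. (\<forall>j. r j \<in> lag F) \<and> (relation_cond i r \<and> r m = 0) \<longrightarrow>
    (\<forall>j. r j = 0))"

text \<open>The index in \<open>3\<close> is the vertex of the triangle \<open>012\<close> at which the relation is taken.\<close>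

definition no_holonomy :: "complex^variable^variable \<Rightarrow> complex \<Rightarrow> bool" where
  "no_holonomy F \<sigma> \<longleftrightarrow> (\<forall>r :: 3 \<times> vertex \<Rightarrow> opr. (\<forall>k. r k \<in> lag F) \<and>
    (relation_cond 0 (\<lambda>j. r (0, j)) \<and> relation_cond 1 (\<lambda>j. r (1, j)) \<and>
     relation_cond 2 (\<lambda>j. r (2, j)) \<and>
     r (1, 2) = 1 *s r (2, 1) \<and> r (2, 0) = 1 *s r (0, 2) \<and> r (0, 1) = \<sigma> *s r (1, 0)) \<longrightarrow>
    (\<forall>k. r k = 0))"

lemma zariski_cond_unique_relations: "zariski_cond (\<lambda>F. unique_relations F im)"
  unfolding unique_relations_def split_beta
  by (intro zariski_cond_kernel linear_cond_conj linear_cond_relation_cond linear_cond_zero)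

lemma zariski_cond_no_holonomy: "zariski_cond (\<lambda>F. no_holonomy F \<sigma>)"
proof -
  have "linear_cond (\<lambda>r :: 3 \<times> vertex \<Rightarrow> opr. relation_cond i (\<lambda>j. r (a, j)))" for i a
    by (rule linear_cond_reindex[OF linear_cond_relation_cond]) (simp add: inj_def)
  then show ?thesis
    unfolding no_holonomy_def by (intro zariski_cond_kernel linear_cond_conj linear_cond_eq) simp_all
qed

definition generic_matrices :: "(complex^variable^variable) set" where
  "generic_matrices = {F \<in> sym_matrices. (\<forall>im\<in>{(i, m). i \<noteq> m}. unique_relations F im) \<and>
    (\<forall>\<sigma>\<in>{1, -1}. no_holonomy F \<sigma>)}"

lemma zariski_open_generic: "zariski_open generic_matrices"
  unfolding generic_matrices_def
  by (intro zariski_open_of_cond zariski_cond_conj zariski_cond_ball zariski_cond_unique_relations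
      zariski_cond_no_holonomy) simp_all

lemma generic_matrices_generic: "F \<in> generic_matrices \<Longrightarrow> generic_lagrangian F"
proof (unfold_locales, goal_cases)
  case 1
  then show ?case
    by (simp add: generic_matrices_def sym_matrices_def)
next
  case (2 i m r j)
  then have "unique_relations F (i, m)"
    by (simp add: generic_matrices_def)
  then show ?case
    using 2 by (simp add: unique_relations_def relations_iff)
next
  case (3 p q r \<sigma>)
  \<comment> \<open>The three relations are packed into the single family over which
    \<open>no_holonomy\<close> quantifies.\<close>
  define R :: "3 \<times> vertex \<Rightarrow> opr"
    where "R k = (if fst k = 0 then p else if fst k = 1 then q else r) (snd k)" for k
  have "no_holonomy F \<sigma>"
    using 3 by (auto simp: generic_matrices_def)
  moreover have "R k \<in> lag F" for k
    using 3 by (auto simp: R_def relations_iff)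
  moreover have R: "(\<lambda>j. R (0, j)) = p" "(\<lambda>j. R (1, j)) = q" "(\<lambda>j. R (2, j)) = r"
    by (simp_all add: R_def)
  moreover have "R (1, 2) = 1 *s R (2, 1) \<and> R (2, 0) = 1 *s R (0, 2) \<and> R (0, 1) = \<sigma> *s R (1, 0)"
    using 3 by (simp add: R_def)
  ultimately have "\<forall>k. R k = 0"
    using 3(2-4) unfolding no_holonomy_def relations_iff by metis
  then have "R (1, 0) = 0"
    by blast
  then show ?case
    by (simp add: R_def)
qed

section \<open>A generic matrix\<close>

lemma UNIV_vertex: "(UNIV :: vertex set) = {0, 1, 2, 3, 4}"
  by (rule distinct5_UNIV) simp

lemma vertex_numerals:
  "(5 :: vertex) = 0" "(6 :: vertex) = 1" "(7 :: vertex) = 2" "(8 :: vertex) = 3"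
  "- (1 :: vertex) = 4" "- (2 :: vertex) = 3" "- (3 :: vertex) = 2" "- (4 :: vertex) = 1"
  by simp_all

lemma all_vertex: "(\<forall>j :: vertex. P j) \<longleftrightarrow> P 0 \<and> P 1 \<and> P 2 \<and> P 3 \<and> P 4"
  using UNIV_vertex by (metis (full_types) UNIV_I insertE singletonD)

lemma sum_vertex: "(\<Sum>j\<in>UNIV. h j) = h 0 + h 1 + h 2 + h 3 + h 4"
  for h :: "vertex \<Rightarrow> 'a::comm_monoid_add"
  unfolding UNIV_vertex by (simp add: add.assoc)

lemma sum_variable: "(\<Sum>p\<in>UNIV. h p) = (\<Sum>i\<in>UNIV. h (X i)) + (\<Sum>i\<in>UNIV. h (Y i))"
  for h :: "variable \<Rightarrow> 'a::comm_monoid_add"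
proof -
  have "(UNIV :: variable set) = range X \<union> range Y" "range X \<inter> range Y = {}"
    by (auto intro: variable.exhaust)
  then have "(\<Sum>p\<in>UNIV. h p) = sum h (range X) + sum h (range Y)"
    by (metis finite sum.union_disjoint)
  then show ?thesis
    by (simp add: sum.reindex inj_def)
qed

text \<open>Vertices are residues modulo 5, and the matrix entries will depend on differences only,
  so that every vertex can be shifted to 0.\<close>

definition circulant :: "vertex \<Rightarrow> complex" where
  "circulant k = (if k = 1 \<or> k = 2 \<or> k = 3 then 1 else 0)"

text \<open>All blocks are anti-diagonal, so that the Lagrangian subspace splits into two dual
  five-dimensional spaces, and edge operators and relations are found by solving scalar equations.
  The holonomy of the triangle \<open>012\<close> has the eigenvalues \<open>-4\<close> and \<open>-1/4\<close>.\<close>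

definition sample_matrix :: "complex^variable^variable" where
  "sample_matrix = (\<chi> p q. case p of
     X i \<Rightarrow> (case q of X j \<Rightarrow> 0 | Y j \<Rightarrow> circulant (j - i))
   | Y j \<Rightarrow> (case q of X i \<Rightarrow> circulant (j - i) | Y i \<Rightarrow> 0))"

lemma sample_symmetric: "sample_matrix \<in> sym_matrices"
  by (auto simp: sym_matrices_def sample_matrix_def transpose_def vec_eq_iff split: variable.split)

definition window :: "(vertex \<Rightarrow> complex) \<Rightarrow> vertex \<Rightarrow> complex" where
  "window v i = v (i + 1) + v (i + 2) + v (i + 3)"

lemma sum_circulant: "(\<Sum>j\<in>UNIV. circulant (j - i) * v j) = window v i"
proof -
  have "(\<Sum>j\<in>UNIV. circulant (j - i) * v j) = (\<Sum>j\<in>UNIV. circulant j * v (i + j))"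
    by (rule sum.reindex_bij_witness[of _ "\<lambda>j. i + j" "\<lambda>j. j - i"]) auto
  then show ?thesis
    by (simp add: sum_vertex circulant_def window_def)
qed

text \<open>Negating all vertices turns the transposed circulant into the original one. This
  explains the negated indices in everything about the \<open>X\<close> half.\<close>

lemma sum_circulant': "(\<Sum>j\<in>UNIV. circulant (i - j) * v j) = window (\<lambda>k. v (- k)) (- i)"
proof -
  have "(\<Sum>j\<in>UNIV. circulant (i - j) * v j) = (\<Sum>j\<in>UNIV. circulant (j - (- i)) * v (- j))"
    by (rule sum.reindex_bij_witness[of _ uminus uminus]) (auto simp: algebra_simps)
  then show ?thesis
    by (simp only: sum_circulant)
qed

lemma lag_sample:
  assumes "d \<in> lag sample_matrix"
  shows "d $ Z (X i) = window (\<lambda>k. d $ D (Y k)) i"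
    and "d $ Z (Y i) = window (\<lambda>k. d $ D (X (- k))) (- i)"
  using assms
  by (auto simp: lag_eq_range sum_variable sample_matrix_def sum_circulant sum_circulant')

text \<open>The vertex relations of one of the two halves: \<open>c j k\<close> is a derivation
  coefficient of the operator on the edge \<open>ij\<close>, and \<open>window\<close> gives the
  matching multiplication coefficients.\<close>

definition scalar_relations :: "vertex \<Rightarrow> (vertex \<Rightarrow> vertex \<Rightarrow> complex) set" where
  "scalar_relations i = {c. (\<forall>k. c i k = 0) \<and> (\<forall>k. (\<Sum>j\<in>UNIV. c j k) = 0) \<and>
    (\<forall>j. j \<noteq> i \<longrightarrow> c j i = 0 \<and> c j j = 0 \<and> window (c j) i = 0 \<and> window (c j) j = 0)}"

lemma relation_Y_part:
  assumes "r \<in> relations sample_matrix i"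
  shows "(\<lambda>j k. r j $ D (Y k)) \<in> scalar_relations i"
proof -
  have "r j $ D (Y i) = 0 \<and> r j $ D (Y j) = 0 \<and> window (\<lambda>k. r j $ D (Y k)) i = 0 \<and>
      window (\<lambda>k. r j $ D (Y k)) j = 0" if "j \<noteq> i" for j
  proof -
    have "r j \<in> edge_space sample_matrix {i, j}"
      using assms that by (auto intro: relations_edge)
    then show ?thesis
      by (auto simp: edge_space_iff component_eq_0_iff lag_sample(1)[symmetric])
  qed
  moreover have "(\<Sum>j\<in>UNIV. r j $ D (Y k)) = 0" "r i $ D (Y k) = 0" for k
    using assms by (simp_all add: relations_def flip: sum_component)
  ultimately show ?thesis
    by (simp add: scalar_relations_def)
qed

text \<open>After negation of the vertices the \<open>X\<close> half obeys the same equations as the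
  \<open>Y\<close> half, so that they are solved only once.\<close>

lemma relation_X_part:
  assumes "r \<in> relations sample_matrix i"
  shows "(\<lambda>j k. r (- j) $ D (X (- k))) \<in> scalar_relations (- i)"
proof -
  have "r (- j) $ D (X i) = 0 \<and> r (- j) $ D (X (- j)) = 0 \<and>
      window (\<lambda>k. r (- j) $ D (X (- k))) (- i) = 0 \<and> window (\<lambda>k. r (- j) $ D (X (- k))) j = 0"
    if "j \<noteq> - i" for j
  proof -
    have "i \<noteq> - j"
      using that by auto
    then have "r (- j) \<in> edge_space sample_matrix {i, - j}"
      using assms by (auto intro: relations_edge)
    then show ?thesis
      using lag_sample(2)[of "r (- j)" i] lag_sample(2)[of "r (- j)" "- j"]
      by (auto simp: edge_space_iff component_eq_0_iff)
  qed
  moreover have "(\<Sum>j\<in>UNIV. r (- j) $ D (X (- k))) = 0" for k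
  proof -
    have "(\<Sum>j\<in>UNIV. r (- j) $ D (X (- k))) = (\<Sum>j\<in>UNIV. r j $ D (X (- k)))"
      by (rule sum.reindex_bij_witness[of _ uminus uminus]) auto
    also have "\<dots> = 0"
      using assms by (simp add: relations_def flip: sum_component)
    finally show ?thesis .
  qed
  moreover have "r i $ D (X (- k)) = 0" for k
    using assms by (simp add: relations_def)
  ultimately show ?thesis
    by (simp add: scalar_relations_def)
qed

lemma lag_sample_zero:
  assumes "d \<in> lag sample_matrix" "\<And>k. d $ D (X k) = 0" "\<And>k. d $ D (Y k) = 0"
  shows "d = 0"
proof -
  have "d $ Z (X k) = 0" "d $ Z (Y k) = 0" for k
    using lag_sample[OF assms(1)] assms(2,3) by (simp_all add: window_def)
  then show ?thesis
    unfolding opr_eq_iff using assms(2,3) by (metis variable.exhaust zero_index)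
qed

lemma scalar_relations_shift:
  assumes "c \<in> scalar_relations i"
  shows "(\<lambda>j k. c (j + i) (k + i)) \<in> scalar_relations 0"
proof -
  have "(\<Sum>j\<in>UNIV. c (j + i) k) = (\<Sum>j\<in>UNIV. c j k)" for k
    by (rule sum.reindex_bij_witness[of _ "\<lambda>j. j - i" "\<lambda>j. j + i"]) auto
  moreover have "window (\<lambda>k. c (j + i) (k + i)) l = window (c (j + i)) (l + i)" for j l
    by (simp add: window_def algebra_simps)
  ultimately show ?thesis
    using assms by (simp add: scalar_relations_def)
qed

text \<open>Solving the equations at the vertex 0 leaves the single parameter
  \<open>t\<close>.\<close>

lemma scalar_relations_0:
  assumes "c \<in> scalar_relations 0"
  defines "t \<equiv> c 1 3"
  shows "c 0 k = 0"
    "c 1 0 = 0" "c 1 1 = 0" "c 1 2 = - t" "c 1 3 = t" "c 1 4 = 0"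
    "c 2 0 = 0" "c 2 1 = t" "c 2 2 = 0" "c 2 3 = - t" "c 2 4 = t"
    "c 3 0 = 0" "c 3 1 = t" "c 3 2 = - t" "c 3 3 = 0" "c 3 4 = - t"
    "c 4 0 = 0" "c 4 1 = - 2 * t" "c 4 2 = 2 * t" "c 4 3 = 0" "c 4 4 = 0"
proof -
  have zero: "c 0 k = 0" for k
    using assms by (simp add: scalar_relations_def)
  have diag: "c j 0 = 0" "c j j = 0" "window (c j) 0 = 0" "window (c j) j = 0" if "j \<noteq> 0" for j
    using assms that by (auto simp: scalar_relations_def)
  have sum: "c 1 k + c 2 k + c 3 k + c 4 k = 0" for k
  proof -
    have "(\<Sum>j\<in>UNIV. c j k) = 0"
      using assms by (simp add: scalar_relations_def)
    then show ?thesis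
      by (simp add: sum_vertex zero)
  qed
  have c1: "c 1 2 + c 1 3 = 0" "c 1 2 + c 1 3 + c 1 4 = 0"
    using diag[of 1] by (simp_all add: window_def)
  have c2: "c 2 1 + c 2 3 = 0" "c 2 3 + c 2 4 = 0"
    using diag[of 2] by (simp_all add: window_def vertex_numerals)
  have c3: "c 3 1 + c 3 2 = 0" "c 3 4 + c 3 1 = 0"
    using diag[of 3] by (simp_all add: window_def vertex_numerals)
  have c4: "c 4 1 + c 4 2 + c 4 3 = 0" "c 4 1 + c 4 2 = 0"
    using diag[of 4] by (simp_all add: window_def vertex_numerals)
  have c14: "c 1 4 = 0" and c43: "c 4 3 = 0"
    using c1 c4 by simp_all
  have c23: "c 2 3 = - t"
    using sum[of 3] diag[of 3] c43 unfolding t_def by (simp add: eq_neg_iff_add_eq_0 add.commute)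
  have c12: "c 1 2 = - t"
    using c1(1) unfolding t_def by (simp add: eq_neg_iff_add_eq_0)
  have c21: "c 2 1 = t" and c24: "c 2 4 = t"
    using c2 c23 by simp_all
  have c34: "c 3 4 = - t"
    using sum[of 4] diag[of 4] c14 c24 by (simp add: eq_neg_iff_add_eq_0 add.commute)
  then have c31: "c 3 1 = t"
    using c3(2) by simp
  then have c32: "c 3 2 = - t"
    using c3(1) by (simp add: eq_neg_iff_add_eq_0 add.commute)
  have c42: "c 4 2 = 2 * t"
    using sum[of 2] diag[of 2] c12 c32 by simp
  then have c41: "c 4 1 = - 2 * t"
    using c4(2) by (simp add: eq_neg_iff_add_eq_0)
  show "c 0 k = 0"
    by (rule zero)
  show "c 1 2 = - t" "c 1 3 = t" "c 1 4 = 0" "c 2 1 = t" "c 2 3 = - t" "c 2 4 = t"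
    "c 3 1 = t" "c 3 2 = - t" "c 3 4 = - t" "c 4 1 = - 2 * t" "c 4 2 = 2 * t" "c 4 3 = 0"
    by (simp_all add: c12 c14 c21 c23 c24 c31 c32 c34 c41 c42 c43 t_def[symmetric])
  show "c 1 0 = 0" "c 1 1 = 0" "c 2 0 = 0" "c 2 2 = 0" "c 3 0 = 0" "c 3 3 = 0" "c 4 0 = 0"
    "c 4 4 = 0"
    by (rule diag, simp)+
qed

lemma scalar_relations_zero:
  assumes "c \<in> scalar_relations i" "c (1 + i) (3 + i) = 0"
  shows "c j k = 0"
proof -
  have "\<forall>j k. c (j + i) (k + i) = 0"
    unfolding all_vertex using scalar_relations_0[OF scalar_relations_shift[OF assms(1)]] assms
    by (simp add: scalar_relations_def)
  from this[rule_format, of "j - i" "k - i"] show ?thesis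
    by simp
qed

text \<open>For every edge at the vertex, some entry is a nonzero multiple of the parameter, so
  vanishing there forces the parameter to be zero.\<close>

lemma scalar_relations_unique:
  assumes c: "c \<in> scalar_relations i" and "m \<noteq> i" "\<And>k. c m k = 0"
  shows "c j k = 0"
proof (rule scalar_relations_zero[OF c])
  note vals = scalar_relations_0[OF scalar_relations_shift[OF c]]
  have "\<forall>j. j \<noteq> 0 \<longrightarrow> (\<forall>k. c (j + i) (k + i) = 0) \<longrightarrow> c (1 + i) (3 + i) = 0"
    unfolding all_vertex using vals by auto
  from this[rule_format, of "m - i"] show "c (1 + i) (3 + i) = 0"
    using assms(2,3) by simp
qed

lemma sample_unique_relations:
  assumes "r \<in> relations sample_matrix i" "m \<noteq> i" "r m = 0"
  shows "r j = 0"
proof (rule lag_sample_zero)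
  show "r j \<in> lag sample_matrix"
    using assms(1) by (simp add: relations_iff)
  show "r j $ D (Y k) = 0" for k
    using scalar_relations_unique[OF relation_Y_part[OF assms(1)], of m] assms(2,3) by simp
  show "r j $ D (X k) = 0" for k
    using scalar_relations_unique[OF relation_X_part[OF assms(1)], of "- m" "- j" "- k"] assms(2,3)
    by simp
qed

text \<open>The two coefficients are the parameters of the \<open>Y\<close> half and of the
  reflected \<open>X\<close> half.\<close>

lemma sample_relation_zero:
  assumes "r \<in> relations sample_matrix i"
    and "r (1 + i) $ D (Y (3 + i)) = 0" "r (i - 1) $ D (X (i - 3)) = 0"
  shows "r j = 0"
proof (rule lag_sample_zero)
  show "r j \<in> lag sample_matrix"
    using assms(1) by (simp add: relations_iff)
  show "r j $ D (Y k) = 0" for k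
    using scalar_relations_zero[OF relation_Y_part[OF assms(1)]] assms(2) by simp
  show "r j $ D (X k) = 0" for k
    using scalar_relations_zero[OF relation_X_part[OF assms(1)], of "- j" "- k"] assms(3) by simp
qed

text \<open>Following the parameters around the triangle gives the factor
  \<open>1 + 4 * \<sigma>\<close> in the \<open>Y\<close> half and \<open>\<sigma> + 4\<close> in
  the \<open>X\<close> half; neither is zero for the given \<open>\<sigma>\<close>.\<close>

lemma sample_no_holonomy:
  assumes p: "p \<in> relations sample_matrix 0" and q: "q \<in> relations sample_matrix 1"
    and r: "r \<in> relations sample_matrix 2"
    and eqs: "q 2 = r 1" "r 0 = p 2" "p 1 = \<sigma> *s q 0" and "\<sigma> = 1 \<or> \<sigma> = -1"
  shows "p j = 0" "q j = 0" "r j = 0"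
proof -
  have \<sigma>: "1 + 4 * \<sigma> \<noteq> 0" "\<sigma> + 4 \<noteq> 0"
    using assms(7) by auto
  note P = scalar_relations_0[OF relation_Y_part[OF p]]
    and Q = scalar_relations_0[OF scalar_relations_shift[OF relation_Y_part[OF q]]]
    and R = scalar_relations_0[OF scalar_relations_shift[OF relation_Y_part[OF r]]]
  \<comment> \<open>Comparing one coefficient on each shared edge links the parameters of
    \<open>q\<close> and \<open>r\<close>, then of \<open>p\<close> and \<open>r\<close>, then of
    \<open>p\<close> and \<open>q\<close>.\<close>
  have "q 2 $ D (Y 4) = 2 * r 3 $ D (Y 0)"
    using R(19) eqs(1) by (simp add: vertex_numerals)
  moreover have "p 1 $ D (Y 3) = - r 3 $ D (Y 0)"
    using R(16) P(8) eqs(2) by (simp add: vertex_numerals)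
  moreover have "p 1 $ D (Y 3) = 2 * \<sigma> * q 2 $ D (Y 4)"
    using P(4) Q(18) eqs(3) by (auto simp: vertex_numerals)
  moreover from calculation have "(1 + 4 * \<sigma>) * r 3 $ D (Y 0) = 0"
    by algebra
  ultimately have Y: "p 1 $ D (Y 3) = 0" "q 2 $ D (Y 4) = 0" "r 3 $ D (Y 0) = 0"
    using \<sigma>(1) by auto
  note P = scalar_relations_0[OF scalar_relations_shift[OF relation_X_part[OF p]]]
    and Q = scalar_relations_0[OF scalar_relations_shift[OF relation_X_part[OF q]]]
    and R = scalar_relations_0[OF scalar_relations_shift[OF relation_X_part[OF r]]]
  have "r 1 $ D (X 4) = 2 * q 0 $ D (X 3)"
    using Q(19) eqs(1) by (simp add: vertex_numerals)
  moreover have "p 4 $ D (X 2) = - r 1 $ D (X 4)"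
    using R(10) P(13) eqs(2) by (simp add: vertex_numerals)
  moreover have "2 * p 4 $ D (X 2) = \<sigma> * q 0 $ D (X 3)"
    using P(18) Q(4) eqs(3) by (simp add: vertex_numerals)
  moreover from calculation have "(\<sigma> + 4) * q 0 $ D (X 3) = 0"
    by algebra
  ultimately have X: "p 4 $ D (X 2) = 0" "q 0 $ D (X 3) = 0" "r 1 $ D (X 4) = 0"
    using \<sigma>(2) by auto
  show "p j = 0"
    using sample_relation_zero[OF p] X Y by (simp add: vertex_numerals)
  show "q j = 0"
    using sample_relation_zero[OF q] X Y by (simp add: vertex_numerals)
  show "r j = 0"
    using sample_relation_zero[OF r] X Y by (simp add: vertex_numerals)
qed

lemma sample_generic: "sample_matrix \<in> generic_matrices"
proof -
  have "unique_relations sample_matrix (i, m)" if "i \<noteq> m" for i m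
    using sample_unique_relations[of _ i m] that by (auto simp: unique_relations_def relations_iff)
  moreover have "no_holonomy sample_matrix \<sigma>" if "\<sigma> = 1 \<or> \<sigma> = -1" for \<sigma>
    unfolding no_holonomy_def
  proof (intro allI impI)
    fix r :: "3 \<times> vertex \<Rightarrow> opr" and k
    assume r: "(\<forall>k. r k \<in> lag sample_matrix) \<and>
      (relation_cond 0 (\<lambda>j. r (0, j)) \<and> relation_cond 1 (\<lambda>j. r (1, j)) \<and>
       relation_cond 2 (\<lambda>j. r (2, j)) \<and>
       r (1, 2) = 1 *s r (2, 1) \<and> r (2, 0) = 1 *s r (0, 2) \<and> r (0, 1) = \<sigma> *s r (1, 0))"
    obtain a :: 3 and j :: vertex where k: "k = (a, j)"
      by (cases k)
    have "r (0, j) = 0" "r (1, j) = 0" "r (2, j) = 0"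
      using sample_no_holonomy[of "\<lambda>j. r (0, j)" "\<lambda>j. r (1, j)" "\<lambda>j. r (2, j)" \<sigma> j] r that
      by (simp_all add: relations_iff)
    moreover have "a = 0 \<or> a = 1 \<or> a = 2"
      using exhaust_3[of a] by auto
    ultimately show "r k = 0"
      using k by auto
  qed
  ultimately show ?thesis
    using sample_symmetric by (auto simp: generic_matrices_def)
qed

theorem theorem3:
  shows "\<exists>U. zariski_open U \<and> U \<noteq> {} \<and> (\<forall>F\<in>U.
    (\<exists>e f A. edge_bases F e f \<and> edge_relations e f A \<and> all_diagonal A) \<and>
    (\<forall>e f A. edge_bases F e f \<and> edge_relations e f A \<and> all_diagonal A \<longrightarrow>
      (\<forall>b\<in>edges. \<forall>b'\<in>edges. \<forall>t. pcomm t (e b) (e b') = 0 \<and> pcomm t (f b) (f b') = 0)) \<and>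
    (\<forall>e f A. edge_bases F e f \<and> edge_relations e f A \<longrightarrow>
      (\<forall>i j k. i \<noteq> j \<and> j \<noteq> k \<and> i \<noteq> k \<longrightarrow>
        (\<exists>\<phi>. maps_basis (e {i, j}) (f {i, j}) (triangle_matrix A i j k) \<phi> \<and>
             bij_betw \<phi> (edge_space F {i, j}) (edge_space F {i, j}) \<and>
             (\<exists>\<mu>. \<mu> \<noteq> 0 \<and> eigenvalues_on (edge_space F {i, j}) \<phi> = {\<mu>, inverse \<mu>})))))"
proof (intro exI[of _ generic_matrices] conjI ballI)
  show "zariski_open generic_matrices"
    by (rule zariski_open_generic)
  show "generic_matrices \<noteq> {}"
    using sample_generic by blast
next
  fix F assume "F \<in> generic_matrices"
  then interpret generic_lagrangian F
    by (rule generic_matrices_generic)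
  show "\<exists>e f A. edge_bases F e f \<and> edge_relations e f A \<and> all_diagonal A"
    by (rule diagonal_bases_exist)
  show "\<forall>e f A. edge_bases F e f \<and> edge_relations e f A \<and> all_diagonal A \<longrightarrow>
      (\<forall>b\<in>edges. \<forall>b'\<in>edges. \<forall>t. pcomm t (e b) (e b') = 0 \<and> pcomm t (f b) (f b') = 0)"
    using diagonal_bases_pcomm by blast
  show "\<forall>e f A. edge_bases F e f \<and> edge_relations e f A \<longrightarrow>
      (\<forall>i j k. i \<noteq> j \<and> j \<noteq> k \<and> i \<noteq> k \<longrightarrow>
        (\<exists>\<phi>. maps_basis (e {i, j}) (f {i, j}) (triangle_matrix A i j k) \<phi> \<and>
             bij_betw \<phi> (edge_space F {i, j}) (edge_space F {i, j}) \<and>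
             (\<exists>\<mu>. \<mu> \<noteq> 0 \<and> eigenvalues_on (edge_space F {i, j}) \<phi> = {\<mu>, inverse \<mu>})))"
    by (intro allI impI triangle_eigenvalues) auto
qed

end
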